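(* Let $\mathbf w=\{w_j\}_{j=1}^\infty$ be a sequence of positive real numbers with $\sigma_{\mathbf w}<+\infty$ and $\delta_{\mathbf w}\in\mathbb R$. Suppose that $\mathbf w$ is multiplicative, i.e., $w_{mn}=w_mw_n$ for all integers $m,n\geq1$ with $\gcd(m,n)=1$, and that $$\frac{w_{p^{j-1}}}{w_{p^j}}\leq p^{-\delta_{\mathbf w}}\quad\text{for all integers } j\geq1\text{ and all prime numbers } p.$$ Then the multiplier algebra $\mathcal M(\mathscr H_{\mathbf w})$ is isometrically isomorphic to $H^\infty(\mathbb H_{\delta_{\mathbf w}/2})\cap\mathcal D$.
   Context: For $\rho\in\mathbb R$, $\mathbb H_\rho=\{s\in\mathbb C:\Re(s)>\rho\}$ (and $\mathbb H_{-\infty}=\mathbb C$). For an integer $n\geq 2$, $\mathrm{gpf}(n)$ is the greatest prime factor of $n$; $\{p_j\}_{j\geq1}$ is the increasing enumeration of the primes. For a sequence $\mathbf x$ of non-negative reals (indexed by $j\geq 1$ here; the term $j=1$ plays no role in the following definitions), $$\sigma_{\mathbf x}=\inf\Big\{\Re(s):\sum_{j=2}^\infty x_jj^{-s}<\infty\Big\},\qquad \delta_{\mathbf x}=\inf\Big\{\Re(s):\sum_{j\geq2,\ \mathrm{gpf}(j)\leq p_n}x_jj^{-s}<\infty\ \text{for all integers } n\geq1\Big\},$$ so that $\delta_{\mathbf x}\leq\sigma_{\mathbf x}$. For a sequence $\mathbf w=\{w_j\}_{j\geq 1}$ of positive reals, $\mathscr H_{\mathbf w}$ is the Hilbert space of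 Dirichlet series $f(s)=\sum_{j=1}^\infty\hat f(j)j^{-s}$ with $\|f\|_{\mathbf w}^2=\sum_{j=1}^\infty|\hat f(j)|^2/w_j<\infty$. If $\sigma_{\mathbf w}<+\infty$, it is a reproducing kernel Hilbert space of holomorphic functions on $\mathbb H_{\sigma_{\mathbf w}/2}$ with kernel $\kappa_{\mathbf w}(s,u)=\sum_{j=1}^\infty w_jj^{-s-\overline u}$. A multiplier of $\mathscr H_{\mathbf w}$ is a function $\varphi:\mathbb H_{\sigma_{\mathbf w}/2}\to\mathbb C$ with $\varphi f\in\mathscr H_{\mathbf w}$ for every $f\in\mathscr H_{\mathbf w}$. $\mathcal M(\mathscr H_{\mathbf w})$ is the algebra of all multipliers, normed by the operator norm of the multiplication operator $M_{\varphi,\mathbf w}:f\mapsto\varphi f$ on $\mathscr H_{\mathbf w}$. $H^\infty(X)$ is the Banach space of bounded holomorphic functions on the open set $X\subseteq\mathbb C$ with the supremum norm, and $\mathcal D$ is the set of all functions representable by a convergent Dirichlet series $\sum_{j\geq1}a_jj^{-s}$ in some right half-plane; $H^\infty(X)\cap\mathcal D$ carries the supremum norm over $X$. *)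

theory Defs
  imports "HOL-Complex_Analysis.Complex_Analysis"
begin

text \<open>
  Sequences indexed by \<open>j \<ge> 1\<close> are functions on \<open>nat\<close> whose value at \<open>0\<close> is never used.
  A function on a set \<open>X\<close> of complex numbers is a function \<open>complex \<Rightarrow> complex\<close> that vanishes
  outside \<open>X\<close>, so that equality of functions on \<open>X\<close> is equality in HOL and the algebra
  operations are the pointwise ones.
\<close>

definition functions_on :: "complex set \<Rightarrow> (complex \<Rightarrow> complex) set" where
  "functions_on X = {f. \<forall>s. s \<notin> X \<longrightarrow> f s = 0}"

definition half_plane :: "ereal \<Rightarrow> complex set" where
  "half_plane \<rho> = {s. \<rho> < ereal (Re s)}"

definition gpf :: "nat \<Rightarrow> nat" where
  "gpf n = Max (prime_factors n)"

text \<open>The primes are enumerated from \<open>nth_prime 1 = 2\<close> on.\<close>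

definition nth_prime :: "nat \<Rightarrow> nat" where
  "nth_prime n = enumerate {p. prime p} (n - 1)"

text \<open>
  The abscissas are used for non-negative \<open>x\<close> only. Finiteness of the sums is unconditional
  summability; for non-negative \<open>x\<close> the infimum is the same as for ordered convergence.
  The infima are taken in the extended reals, so that the infimum of the empty set is \<open>\<infinity>\<close>.
\<close>

definition sigma_abscissa :: "(nat \<Rightarrow> real) \<Rightarrow> ereal" where
  "sigma_abscissa x = Inf {ereal (Re s) | s.
     (\<lambda>j. of_real (x j) * of_nat j powr (- s)) summable_on {j. 2 \<le> j}}"

definition delta_abscissa :: "(nat \<Rightarrow> real) \<Rightarrow> ereal" where
  "delta_abscissa x = Inf {ereal (Re s) | s. \<forall>n\<ge>1.
     (\<lambda>j. of_real (x j) * of_nat j powr (- s)) summable_on {j. 2 \<le> j \<and> gpf j \<le> nth_prime n}}"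

definition dirichlet_sums :: "(nat \<Rightarrow> complex) \<Rightarrow> complex \<Rightarrow> complex \<Rightarrow> bool" where
  "dirichlet_sums a s z \<longleftrightarrow> (\<lambda>j. a (Suc j) * of_nat (Suc j) powr (- s)) sums z"

definition has_dirichlet_series :: "(complex \<Rightarrow> complex) \<Rightarrow> (nat \<Rightarrow> complex) \<Rightarrow> bool" where
  "has_dirichlet_series f a \<longleftrightarrow> (\<exists>\<rho>::real. \<forall>s\<in>half_plane (ereal \<rho>). dirichlet_sums a s (f s))"

definition dirichlet_representable :: "(complex \<Rightarrow> complex) set" where
  "dirichlet_representable = {f. \<exists>a. has_dirichlet_series f a}"

text \<open>
  The coefficients at \<open>j \<ge> 1\<close> are determined by the function, by the uniqueness theorem for
  Dirichlet series; the unused entry at \<open>0\<close> is fixed to be \<open>0\<close>.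
\<close>

definition dirichlet_coeff :: "(complex \<Rightarrow> complex) \<Rightarrow> nat \<Rightarrow> complex" where
  "dirichlet_coeff f = (THE a. a 0 = 0 \<and> has_dirichlet_series f a)"

definition H_domain :: "(nat \<Rightarrow> real) \<Rightarrow> complex set" where
  "H_domain w = half_plane (sigma_abscissa w / 2)"

definition H_space :: "(nat \<Rightarrow> real) \<Rightarrow> (complex \<Rightarrow> complex) set" where
  "H_space w = {f \<in> functions_on (H_domain w). \<exists>a.
     summable (\<lambda>j. (cmod (a (Suc j)))\<^sup>2 / w (Suc j)) \<and>
     (\<forall>s\<in>H_domain w. dirichlet_sums a s (f s))}"

definition H_norm :: "(nat \<Rightarrow> real) \<Rightarrow> (complex \<Rightarrow> complex) \<Rightarrow> real" where
  "H_norm w f = sqrt (\<Sum>j. (cmod (dirichlet_coeff f (Suc j)))\<^sup>2 / w (Suc j))"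

definition multipliers :: "(nat \<Rightarrow> real) \<Rightarrow> (complex \<Rightarrow> complex) set" where
  "multipliers w = {\<phi> \<in> functions_on (H_domain w).
     \<forall>f\<in>H_space w. (\<lambda>s. \<phi> s * f s) \<in> H_space w}"

text \<open>
  The operator norm of multiplication by \<open>\<phi>\<close>. The supremum is over a bounded set of reals
  for every multiplier, by the closed graph theorem.
\<close>

definition multiplier_norm :: "(nat \<Rightarrow> real) \<Rightarrow> (complex \<Rightarrow> complex) \<Rightarrow> real" where
  "multiplier_norm w \<phi> = (SUP f\<in>{f \<in> H_space w. H_norm w f \<le> 1}. H_norm w (\<lambda>s. \<phi> s * f s))"

definition H_infinity :: "complex set \<Rightarrow> (complex \<Rightarrow> complex) set" where
  "H_infinity X = {f \<in> functions_on X. f holomorphic_on X \<and> bounded (f ` X)}"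

definition sup_norm :: "complex set \<Rightarrow> (complex \<Rightarrow> complex) \<Rightarrow> real" where
  "sup_norm X f = (SUP s\<in>X. cmod (f s))"

text \<open>
  Isometric isomorphism, as complex algebras, of two algebras of functions with pointwise
  operations and norms \<open>nA\<close> and \<open>nB\<close>.
\<close>

definition isometrically_isomorphic ::
  "(complex \<Rightarrow> complex) set \<Rightarrow> ((complex \<Rightarrow> complex) \<Rightarrow> real) \<Rightarrow>
   (complex \<Rightarrow> complex) set \<Rightarrow> ((complex \<Rightarrow> complex) \<Rightarrow> real) \<Rightarrow> bool" where
  "isometrically_isomorphic A nA B nB \<longleftrightarrow> (\<exists>\<Phi>. bij_betw \<Phi> A B \<and>
     (\<forall>f\<in>A. \<forall>g\<in>A. \<Phi> (\<lambda>s. f s + g s) = (\<lambda>s. \<Phi> f s + \<Phi> g s)) \<and>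
     (\<forall>f\<in>A. \<forall>c. \<Phi> (\<lambda>s. c * f s) = (\<lambda>s. c * \<Phi> f s)) \<and>
     (\<forall>f\<in>A. \<forall>g\<in>A. \<Phi> (\<lambda>s. f s * g s) = (\<lambda>s. \<Phi> f s * \<Phi> g s)) \<and>
     (\<forall>f\<in>A. nB (\<Phi> f) = nA f))"

end

theory Submission
  imports Defs
begin

text \<open>
  Write \<open>\<delta>\<close> and \<open>\<sigma>\<close> for the two abscissas of \<open>w\<close>. Passing to coefficients identifies the Hilbert
  space with the weighted sequence space \<open>ell2 w\<close>, and a multiplier with a sequence \<open>a\<close> that acts on
  it by Dirichlet convolution. The isomorphism extends a multiplier from the half-plane
  \<open>Re s > \<sigma> / 2\<close> to the half-plane \<open>Re s > \<delta> / 2\<close>. By the identity theorem extensions are unique and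
  compatible with the algebra operations, so that two norm inequalities remain.

  From multipliers to bounded functions. A multiplier is a bounded operator
  (\<open>triangular_operator_bounded\<close>). The integers whose prime factors are at most \<open>n\<close> are closed under
  products and divisors, so restricting coefficients to them is compatible with convolution; on the
  functions with such frequencies the reproducing kernel exists for all \<open>Re s > \<delta> / 2\<close>. The value at
  \<open>s\<close> of the restricted multiplier is, up to conjugation, an eigenvalue of the adjoint of a compression of the
  multiplication operator, and is therefore at most its norm (\<open>smooth_part_bound\<close>). Letting \<open>n\<close> tend to infinity,
  Montel's theorem provides the extension (\<open>multiplier_extends\<close>).

  From bounded functions to multipliers. Let \<open>\<phi>\<close> be bounded by \<open>K\<close> and let \<open>f\<close> be a Dirichlet polynomial.
  Means over vertical lines do not depend on the line (\<open>mean_shift\<close>), so they detect the coefficients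
  of \<open>\<phi> f\<close> even where its series is not known to converge, and Bessel's inequality bounds these
  coefficients by \<open>K\<close> times those of \<open>f\<close>. This holds for the sums over the divisors of any \<open>N\<close>, with the
  weight \<open>j powr (- \<delta>)\<close> (\<open>bessel_on_divisors\<close>). Multiplicativity and the growth condition say that
  \<open>1 / w j\<close> is \<open>j powr (- \<delta>)\<close> times a product, over the primes, of nonincreasing functions of the
  exponents of \<open>j\<close>. Such a product is a nonnegative combination of the indicators of the sets of
  divisors of single integers, so the inequality passes to the weight \<open>1 / w j\<close> by Abel summation in each
  prime (\<open>divisor_sums_weight\<close>).
\<close>

section \<open>Absolutely convergent Dirichlet series\<close>

text \<open>As \<open>0 powr z = 0\<close>, the coefficient at \<open>0\<close> never contributes to the series below.\<close>

definition dirichlet_value :: "(nat \<Rightarrow> complex) \<Rightarrow> complex \<Rightarrow> complex" where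
  "dirichlet_value a s = (\<Sum>j. a j * of_nat j powr (- s))"

definition converges_absolutely :: "(nat \<Rightarrow> complex) \<Rightarrow> real \<Rightarrow> bool" where
  "converges_absolutely a x \<longleftrightarrow> summable (\<lambda>j. cmod (a j) * real j powr (- x))"

definition dirichlet_conv :: "(nat \<Rightarrow> complex) \<Rightarrow> (nat \<Rightarrow> complex) \<Rightarrow> nat \<Rightarrow> complex" where
  "dirichlet_conv a b j = (\<Sum>d | d dvd j. a d * b (j div d))"

lemma norm_nat_powr: "cmod (of_nat j powr (- s)) = real j powr (- Re s)"
proof (cases "j = 0")
  case False
  then show ?thesis
    using norm_powr_real_powr[of "complex_of_nat j" "-s"] by simp
qed simp

lemma nat_powr_mult:
  "complex_of_nat (m * k) powr s = of_nat m powr s * of_nat k powr s"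
  using powr_times_real_left[of "complex_of_nat m" "complex_of_nat k" s] by auto

lemma nat_powr_antimono: "x \<le> y \<Longrightarrow> real j powr (- y) \<le> real j powr (- x)"
  by (cases "j = 0") (auto intro: powr_mono)

lemma converges_absolutely_mono:
  assumes "converges_absolutely a x" "x \<le> y"
  shows "converges_absolutely a y"
  unfolding converges_absolutely_def
proof (rule summable_comparison_test'[OF assms(1)[unfolded converges_absolutely_def], of 0])
  fix j show "norm (cmod (a j) * real j powr (- y)) \<le> cmod (a j) * real j powr (- x)"
    using nat_powr_antimono[OF assms(2), of j] by (simp add: mult_left_mono)
qed

lemma dirichlet_summable_norm:
  assumes "converges_absolutely a x" "x \<le> Re s"
  shows "summable (\<lambda>j. norm (a j * of_nat j powr (- s)))"
  using converges_absolutely_mono[OF assms]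
  by (simp add: converges_absolutely_def norm_mult norm_nat_powr)

lemma dirichlet_value_sums:
  assumes "converges_absolutely a x" "x \<le> Re s"
  shows "(\<lambda>j. a j * of_nat j powr (- s)) sums dirichlet_value a s"
  unfolding dirichlet_value_def
  by (rule summable_sums[OF summable_norm_cancel[OF dirichlet_summable_norm[OF assms]]])

lemma dirichlet_sums_iff: "dirichlet_sums a s z \<longleftrightarrow> (\<lambda>j. a j * of_nat j powr (- s)) sums z"
  unfolding dirichlet_sums_def
  using sums_Suc_iff[of "\<lambda>j. a j * of_nat j powr (- s)" z] by simp

lemma dirichlet_sums_value:
  "converges_absolutely a x \<Longrightarrow> x \<le> Re s \<Longrightarrow> dirichlet_sums a s (dirichlet_value a s)"
  by (simp add: dirichlet_sums_iff dirichlet_value_sums)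

lemma dirichlet_value_unique: "dirichlet_sums a s z \<Longrightarrow> dirichlet_value a s = z"
  unfolding dirichlet_sums_iff dirichlet_value_def by (rule sums_unique[symmetric])

text \<open>At a point of convergence the terms are bounded; two units further to the right they have
  gained the summable factor \<open>j powr (- 2)\<close>.\<close>

lemma has_dirichlet_series_absolutely:
  assumes "has_dirichlet_series f a"
  obtains x where "converges_absolutely a x" "\<And>s. x \<le> Re s \<Longrightarrow> f s = dirichlet_value a s"
proof -
  obtain \<rho> where \<rho>: "\<And>s. s \<in> half_plane (ereal \<rho>) \<Longrightarrow> dirichlet_sums a s (f s)"
    using assms unfolding has_dirichlet_series_def by blast
  define y where "y = \<rho> + 1"
  have "complex_of_real y \<in> half_plane (ereal \<rho>)"
    by (simp add: y_def half_plane_def)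
  from \<rho>[OF this] have "summable (\<lambda>j. a j * of_nat j powr (- complex_of_real y))"
    by (auto simp: dirichlet_sums_iff summable_def)
  then have "(\<lambda>j. a j * of_nat j powr (- complex_of_real y)) \<longlonglongrightarrow> 0"
    by (rule summable_LIMSEQ_zero)
  then have "Bseq (\<lambda>j. a j * of_nat j powr (- complex_of_real y))"
    using convergentI convergent_imp_Bseq by blast
  then obtain B where B: "\<And>j. cmod (a j) * real j powr (- y) \<le> B"
    using norm_nat_powr[of _ "complex_of_real y"]
    by (fastforce simp: Bseq_def norm_mult)
  have "converges_absolutely a (y + 2)"
    unfolding converges_absolutely_def
  proof (rule summable_comparison_test'[of "\<lambda>j. B * real j powr (- 2)" 0])
    show "summable (\<lambda>j. B * real j powr (- 2))"
      by (intro summable_mult) (simp add: summable_real_powr_iff)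
    fix j
    have "real j powr (- (y + 2)) = real j powr (- y) * real j powr (- 2)"
      by (simp add: powr_add[symmetric])
    then show "norm (cmod (a j) * real j powr (- (y + 2))) \<le> B * real j powr (- 2)"
      using mult_right_mono[OF B[of j], of "real j powr (- 2)"] by (simp add: mult.assoc)
  qed
  moreover have "f s = dirichlet_value a s" if "y + 2 \<le> Re s" for s
  proof -
    have "s \<in> half_plane (ereal \<rho>)" using that by (simp add: half_plane_def y_def)
    then show ?thesis using \<rho> dirichlet_value_unique by metis
  qed
  ultimately show ?thesis using that by blast
qed

text \<open>The terms are dominated by their size on the line \<open>Re s = x\<close>, so the convergence is uniform.\<close>

lemma dirichlet_value_holomorphic:
  assumes "converges_absolutely a x"
  shows "dirichlet_value a holomorphic_on {s. x < Re s}"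
proof -
  have op: "open {s. x < Re s}" by (simp add: open_halfspace_Re_gt)
  have "(\<lambda>s. a j * of_nat j powr (- s)) holomorphic_on {s. x < Re s}" for j
    by (cases "j = 0") (auto intro!: holomorphic_intros)
  then have fd: "(\<lambda>s. a j * of_nat j powr (- s)) field_differentiable (at s)"
    if "s \<in> {s. x < Re s}" for j s
    using holomorphic_on_imp_differentiable_at[OF _ op that] by blast
  have bound: "\<exists>d h. 0 < d \<and> summable h \<and> range h \<subseteq> \<real>\<^sub>\<ge>\<^sub>0 \<and> (\<forall>\<^sub>F n in sequentially.
      \<forall>y\<in>ball s d \<inter> {s. x < Re s}. cmod (a n * of_nat n powr (- y)) \<le> cmod (h n))" for s
  proof (intro exI conjI)
    let ?h = "\<lambda>n. complex_of_real (cmod (a n) * real n powr (- x))"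
    show "summable ?h"
      using assms unfolding converges_absolutely_def by (rule summable_of_real)
    show "range ?h \<subseteq> \<real>\<^sub>\<ge>\<^sub>0" by (auto simp del: of_real_mult)
    show "\<forall>\<^sub>F n in sequentially. \<forall>y\<in>ball s 1 \<inter> {s. x < Re s}.
        cmod (a n * of_nat n powr (- y)) \<le> cmod (?h n)"
      by (intro always_eventually allI ballI)
        (auto simp: norm_mult norm_nat_powr intro!: mult_left_mono nat_powr_antimono)
  qed auto
  obtain g where g: "\<forall>s\<in>{s. x < Re s}.
      ((\<lambda>n. a n * of_nat n powr (- s)) sums g s) \<and> g field_differentiable (at s)"
    by (rule series_differentiable_comparison_complex[OF op fd bound])
  have "g holomorphic_on {s. x < Re s}"
    using g by (simp add: holomorphic_on_def field_differentiable_at_within)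
  moreover have "g s = dirichlet_value a s" if "s \<in> {s. x < Re s}" for s
    using g that unfolding dirichlet_value_def by (simp add: sums_unique)
  ultimately show ?thesis by (rule holomorphic_transform)
qed

lemma dirichlet_conv_0 [simp]: "dirichlet_conv a b 0 = 0"
  by (simp add: dirichlet_conv_def)

text \<open>Rearranged along the products \<open>j = d * k\<close>, the double series of the two factors is the
  series of the convolution.\<close>

lemma dirichlet_conv_has_sum:
  assumes "(\<lambda>j. norm (a j * of_nat j powr (- s))) summable_on {1..}"
    and "(\<lambda>j. norm (b j * of_nat j powr (- s))) summable_on {1..}"
  shows "(\<lambda>j. norm (dirichlet_conv a b j * of_nat j powr (- s))) summable_on {1..}"
    and "infsum (\<lambda>j. dirichlet_conv a b j * of_nat j powr (- s)) {1..}
      = infsum (\<lambda>j. a j * of_nat j powr (- s)) {1..} * infsum (\<lambda>j. b j * of_nat j powr (- s)) {1..}"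
proof -
  let ?A = "\<lambda>j. a j * of_nat j powr (- s)" and ?B = "\<lambda>j. b j * of_nat j powr (- s)"
  let ?T = "SIGMA j:{1::nat..}. {d. d dvd j}"
  let ?h = "\<lambda>(j, d). (d, j div d)"
  let ?F = "\<lambda>(j, d). ?A d * ?B (j div d)"
  have bij: "bij_betw ?h ?T ({1..} \<times> {1..})"
  proof (rule bij_betwI[where g = "\<lambda>(d, k). (d * k, d)"])
    have "1 \<le> d \<and> 1 \<le> j div d" if "1 \<le> j" "d dvd j" for j d :: nat
      using that by (cases "d = 0") (auto simp: Suc_le_eq div_greater_zero_iff dvd_imp_le)
    then show "?h \<in> ?T \<rightarrow> {1..} \<times> {1..}" by fastforce
  qed auto
  have prod: "(\<lambda>x. norm (case x of (d, k) \<Rightarrow> ?A d * ?B k)) summable_on {1..} \<times> {1..}"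
    using Infinite_Sum.abs_summable_on_Sigma_iff[of "\<lambda>(d, k). ?A d * ?B k" "{1..}" "\<lambda>_. {1..}"] assms
    by (auto simp: norm_mult abs_mult intro!: summable_on_cmult_right summable_on_cmult_left
        simp: infsum_cmult_right')
  have F: "(\<lambda>x. norm (?F x)) summable_on ?T"
    using summable_on_reindex_bij_betw[OF bij, of "\<lambda>x. norm (case x of (d, k) \<Rightarrow> ?A d * ?B k)"] prod
    by (simp add: case_prod_unfold)
  have inner: "(\<Sum>d | d dvd j. ?A d * ?B (j div d)) = dirichlet_conv a b j * of_nat j powr (- s)"
    if "j \<in> {1..}" for j
  proof -
    have "?A d * ?B (j div d) = a d * b (j div d) * of_nat j powr (- s)" if "d dvd j" for d
      using nat_powr_mult[of d "j div d" "-s"] that by (simp add: mult_ac)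
    then show ?thesis by (auto simp: dirichlet_conv_def sum_distrib_right intro!: sum.cong)
  qed
  have fin: "finite {d. d dvd j}" if "j \<in> {1..}" for j :: nat
    using that by auto
  have "(\<lambda>j. infsum (\<lambda>d. norm (?A d * ?B (j div d))) {d. d dvd j}) summable_on {1..}"
    using F Infinite_Sum.abs_summable_on_Sigma_iff[of ?F "{1..}" "\<lambda>j. {d. d dvd j}"]
    by (auto simp: abs_of_nonneg infsum_nonneg)
  then have sm: "(\<lambda>j. \<Sum>d | d dvd j. norm (?A d * ?B (j div d))) summable_on {1..}"
    by (rule summable_on_cong[THEN iffD1, rotated]) (use fin in auto)
  show "(\<lambda>j. norm (dirichlet_conv a b j * of_nat j powr (- s))) summable_on {1..}"
  proof (rule summable_on_comparison_test[OF sm])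
    fix j :: nat assume "j \<in> {1..}"
    then show "norm (dirichlet_conv a b j * of_nat j powr (- s))
        \<le> (\<Sum>d | d dvd j. norm (?A d * ?B (j div d)))"
      using norm_sum[of "\<lambda>d. ?A d * ?B (j div d)" "{d. d dvd j}"] inner[of j] by simp
  qed auto
  have "infsum ?A {1..} * infsum ?B {1..} = infsum (\<lambda>(d, k). ?A d * ?B k) ({1..} \<times> {1..})"
    using infsum_Sigma'_banach[OF Infinite_Sum.abs_summable_summable[OF prod]]
    by (simp add: infsum_cmult_right' infsum_cmult_left')
  also have "\<dots> = infsum ?F ?T"
    using infsum_reindex_bij_betw[OF bij, of "\<lambda>(d, k). ?A d * ?B k"]
    by (simp add: case_prod_unfold)
  also have "\<dots> = infsum (\<lambda>j. infsum (\<lambda>d. ?A d * ?B (j div d)) {d. d dvd j}) {1..}"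
    using infsum_Sigma'_banach[of "\<lambda>j d. ?A d * ?B (j div d)" "{1..}" "\<lambda>j. {d. d dvd j}"]
      Infinite_Sum.abs_summable_summable[OF F] by simp
  also have "\<dots> = infsum (\<lambda>j. dirichlet_conv a b j * of_nat j powr (- s)) {1..}"
    by (rule infsum_cong) (use fin inner in auto)
  finally show "infsum (\<lambda>j. dirichlet_conv a b j * of_nat j powr (- s)) {1..}
      = infsum ?A {1..} * infsum ?B {1..}" by simp
qed

lemma converges_absolutely_summable_on:
  "converges_absolutely a (Re s) \<longleftrightarrow> (\<lambda>j. norm (a j * of_nat j powr (- s))) summable_on {1..}"
proof -
  have "(\<lambda>j. norm (a j * of_nat j powr (- s))) summable_on {1..}
      \<longleftrightarrow> (\<lambda>j. norm (a j * of_nat j powr (- s))) summable_on UNIV"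
    by (rule summable_on_cong_neutral) (auto simp: not_le)
  then show ?thesis
    by (simp add: converges_absolutely_def summable_on_UNIV_nonneg_real_iff norm_mult norm_nat_powr)
qed

lemma dirichlet_value_infsum:
  assumes "converges_absolutely a (Re s)"
  shows "dirichlet_value a s = infsum (\<lambda>j. a j * of_nat j powr (- s)) {1..}"
proof -
  have "((\<lambda>j. a j * of_nat j powr (- s)) has_sum dirichlet_value a s) UNIV"
    using norm_summable_imp_has_sum[OF dirichlet_summable_norm[OF assms order_refl]
        dirichlet_value_sums[OF assms order_refl]] .
  then have "infsum (\<lambda>j. a j * of_nat j powr (- s)) UNIV = dirichlet_value a s"
    by (rule infsumI)
  moreover have "infsum (\<lambda>j. a j * of_nat j powr (- s)) {1..}
      = infsum (\<lambda>j. a j * of_nat j powr (- s)) UNIV"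
    by (rule infsum_cong_neutral) (auto simp: not_le)
  ultimately show ?thesis by simp
qed

lemma dirichlet_conv_converges:
  assumes "converges_absolutely a x" "converges_absolutely b x"
  shows "converges_absolutely (dirichlet_conv a b) x"
  using dirichlet_conv_has_sum(1)[of a "of_real x" b] assms
    converges_absolutely_summable_on[of _ "of_real x"] by simp

lemma dirichlet_conv_value:
  assumes "converges_absolutely a x" "converges_absolutely b x" "x \<le> Re s"
  shows "dirichlet_value (dirichlet_conv a b) s = dirichlet_value a s * dirichlet_value b s"
proof -
  have ab: "converges_absolutely a (Re s)" "converges_absolutely b (Re s)"
    using assms converges_absolutely_mono by blast+
  then show ?thesis
    using dirichlet_conv_has_sum(2)[of a s b] dirichlet_conv_converges[OF ab]
    by (simp add: dirichlet_value_infsum converges_absolutely_summable_on)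
qed

section \<open>Mean values on vertical lines\<close>

definition mean :: "(real \<Rightarrow> complex) \<Rightarrow> real \<Rightarrow> complex" where
  "mean h T = integral {- T..T} h / of_real (2 * T)"

lemma mean_bound:
  assumes "T > 0" "continuous_on UNIV h" "\<And>t. cmod (h t) \<le> B"
  shows "cmod (mean h T) \<le> B"
proof -
  have "cmod (integral {- T..T} h) \<le> B * (T - - T)"
    using assms(1,3) continuous_on_subset[OF assms(2)] by (intro integral_bound) auto
  then show ?thesis
    using assms(1) by (simp add: mean_def norm_divide field_simps)
qed

lemma mean_tendsto_0:
  assumes "\<And>T. T > 0 \<Longrightarrow> cmod (m T) \<le> B / T"
  shows "((m :: real \<Rightarrow> complex) \<longlongrightarrow> 0) at_top"
proof (rule Lim_null_comparison)
  show "\<forall>\<^sub>F T in at_top. cmod (m T) \<le> B / T"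
    using eventually_gt_at_top[of 0] by eventually_elim (rule assms)
  show "((\<lambda>T. B / T) \<longlongrightarrow> 0) at_top"
    by (intro real_tendsto_divide_at_top[OF tendsto_const] filterlim_ident)
qed

lemma mean_oscillation:
  "((\<lambda>T. mean (\<lambda>t. exp (\<i> * of_real (c * t))) T) \<longlongrightarrow> (if c = 0 then 1 else 0)) at_top"
proof (cases "c = 0")
  case True
  have "\<forall>\<^sub>F T in at_top. mean (\<lambda>t. exp (\<i> * of_real (c * t))) T = 1"
    using eventually_gt_at_top[of 0] by eventually_elim (simp add: True mean_def scaleR_conv_of_real)
  then show ?thesis
    using True tendsto_eventually by fastforce
next
  case False
  let ?F = "\<lambda>t. exp (\<i> * of_real (c * t)) / (\<i> * of_real c)"
  have v: "cmod (?F u) = 1 / \<bar>c\<bar>" for u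
    by (simp add: norm_divide norm_mult norm_exp_eq_Re)
  have "cmod (mean (\<lambda>t. exp (\<i> * of_real (c * t))) T) \<le> (1 / \<bar>c\<bar>) / T" if "T > 0" for T
  proof -
    have "((\<lambda>t. exp (\<i> * of_real (c * t))) has_integral ?F T - ?F (- T)) {- T..T}"
    proof (rule fundamental_theorem_of_calculus)
      fix t
      have "((\<lambda>z. exp (\<i> * (of_real c * z)) / (\<i> * of_real c)) has_field_derivative
          exp (\<i> * (of_real c * of_real t))) (at (of_real t))"
        using False by (auto intro!: derivative_eq_intros simp: algebra_simps)
      then show "(?F has_vector_derivative exp (\<i> * of_real (c * t))) (at t within {- T..T})"
        using has_vector_derivative_real_field has_vector_derivative_at_within by fastforce
    qed (use that in simp)
    then have "mean (\<lambda>t. exp (\<i> * of_real (c * t))) T = (?F T - ?F (- T)) / of_real (2 * T)"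
      unfolding mean_def by (simp only: integral_unique)
    then have "cmod (mean (\<lambda>t. exp (\<i> * of_real (c * t))) T) = cmod (?F T - ?F (- T)) / (2 * T)"
      using that by (simp only: norm_divide norm_of_real)
    also have "\<dots> \<le> (cmod (?F T) + cmod (?F (- T))) / (2 * T)"
      using that by (intro divide_right_mono norm_triangle_ineq4) simp
    also have "\<dots> = (1 / \<bar>c\<bar>) / T"
      unfolding v by simp
    finally show ?thesis .
  qed
  then show ?thesis
    using False mean_tendsto_0[of "mean (\<lambda>t. exp (\<i> * of_real (c * t)))" "1 / \<bar>c\<bar>"] by simp
qed

lemma norm_pos_powr: "l > 0 \<Longrightarrow> cmod (of_real l powr s) = l powr Re s"
  by (simp add: norm_powr_real_powr)

lemma continuous_on_powr_line [continuous_intros]: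
  "continuous_on A (\<lambda>t. (c :: complex) powr Complex x t)"
  "continuous_on A (\<lambda>t. (c :: complex) powr (- Complex x t))"
  by (cases "c = 0"; auto simp: powr_def Complex_eq intro!: continuous_intros)+

text \<open>Averaging the series against \<open>l powr s\<close> along a vertical line of absolute convergence
  singles out the frequency \<open>l\<close>.\<close>

lemma mean_dirichlet_value:
  assumes "converges_absolutely a x" "l > 0"
  shows "((mean (\<lambda>t. dirichlet_value a (Complex x t) * of_real l powr Complex x t))
    \<longlongrightarrow> (\<Sum>j. if real j = l then a j else 0)) at_top"
proof -
  let ?e = "\<lambda>j t. a j * of_nat j powr (- Complex x t) * of_real l powr Complex x t"
  let ?M = "\<lambda>j. cmod (a j) * real j powr (- x) * l powr x"
  have sM: "summable ?M"
    using assms(1) unfolding converges_absolutely_def by (rule summable_mult2)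
  have bound: "cmod (?e j t) \<le> ?M j" for j t
    using assms(2) by (simp add: norm_mult norm_nat_powr norm_pos_powr)
  have cont: "continuous_on A (?e j)" for j A
    by (intro continuous_intros)
  have sum_e: "(\<Sum>j. ?e j t) = dirichlet_value a (Complex x t) * of_real l powr Complex x t" for t
    unfolding dirichlet_value_def
    by (rule suminf_mult2[symmetric])
      (use dirichlet_summable_norm[OF assms(1), of "Complex x t"] summable_norm_cancel in auto)
  have interchange: "mean (\<lambda>t. \<Sum>j. ?e j t) T = (\<Sum>j. mean (?e j) T)" for T
  proof -
    have ul: "uniform_limit {- T..T} (\<lambda>n t. \<Sum>j<n. ?e j t) (\<lambda>t. \<Sum>j. ?e j t) sequentially"
      by (rule Weierstrass_m_test[OF bound sM])
    have cs: "continuous_on {- T..T} (\<lambda>t. \<Sum>j<n. ?e j t)" for n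
      by (intro continuous_on_sum cont)
    obtain I J where I: "\<And>n. ((\<lambda>t. \<Sum>j<n. ?e j t) has_integral I n) {- T..T}"
      and J: "((\<lambda>t. \<Sum>j. ?e j t) has_integral J) {- T..T}" and IJ: "I \<longlonglongrightarrow> J"
      by (rule uniform_limit_integral[OF ul cs sequentially_bot]) (rule that)
    have "I = (\<lambda>n. \<Sum>j<n. integral {- T..T} (?e j))"
    proof
      show "I n = (\<Sum>j<n. integral {- T..T} (?e j))" for n
        using integral_unique[OF I[of n]] integral_sum[of "{..<n}" ?e "{- T..T}"]
          integrable_continuous_interval[OF cont] by simp
    qed
    then have "(\<lambda>j. integral {- T..T} (?e j)) sums J"
      using IJ by (simp add: sums_def)
    then have "(\<lambda>j. mean (?e j) T) sums (J / of_real (2 * T))"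
      unfolding mean_def by (rule sums_divide)
    moreover have "mean (\<lambda>t. \<Sum>j. ?e j t) T = J / of_real (2 * T)"
      using J by (simp add: mean_def integral_unique)
    ultimately show ?thesis by (simp add: sums_iff)
  qed
  have single: "(mean (?e j) \<longlongrightarrow> (if real j = l then a j else 0)) at_top" for j
  proof (cases "j = 0")
    case True
    then show ?thesis using assms(2) by (simp add: mean_def[abs_def])
  next
    case False
    let ?c = "ln l - ln (real j)"
    let ?C = "a j * of_real ((l / real j) powr x)"
    have e: "?e j t = ?C * exp (\<i> * of_real (?c * t))" for t
    proof -
      have "of_nat j powr (- Complex x t) * of_real l powr Complex x t
          = exp (of_real ?c * Complex x t)"
        using False assms(2)
        by (simp add: powr_def Ln_of_nat Ln_of_real exp_add[symmetric] algebra_simps)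
      also have "\<dots> = of_real (exp (?c * x)) * exp (\<i> * of_real (?c * t))"
        by (simp add: exp_of_real[symmetric] exp_add[symmetric] Complex_eq algebra_simps)
      also have "exp (?c * x) = (l / real j) powr x"
        using False assms(2) by (simp add: powr_def ln_div mult.commute)
      finally show ?thesis by simp
    qed
    have "mean (?e j) = (\<lambda>T. ?C * mean (\<lambda>t. exp (\<i> * of_real (?c * t))) T)"
      unfolding e mean_def by (auto simp: integral_mult_right)
    moreover have "((\<lambda>T. ?C * mean (\<lambda>t. exp (\<i> * of_real (?c * t))) T)
        \<longlongrightarrow> ?C * (if ?c = 0 then 1 else 0)) at_top"
      by (intro tendsto_mult tendsto_const mean_oscillation)
    moreover have "?C * (if ?c = 0 then 1 else 0) = (if real j = l then a j else 0)"
      using False assms(2) by auto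
    ultimately show ?thesis by simp
  qed
  have "\<forall>\<^sub>F T in at_top. T > (0::real)" by (rule eventually_gt_at_top)
  then have "\<forall>\<^sub>F (k, T) in sequentially \<times>\<^sub>F at_top. cmod (mean (?e k) T) \<le> ?M k"
    by (subst eventually_prod_filter)
      (auto intro!: exI[of _ "\<lambda>_. True"] exI[of _ "\<lambda>T. T > (0::real)"] mean_bound[OF _ cont bound])
  from tannerys_theorem[OF single this sM trivial_limit_at_top_linorder]
  have "((\<lambda>T. \<Sum>j. mean (?e j) T) \<longlongrightarrow> (\<Sum>j. if real j = l then a j else 0)) at_top"
    by blast
  then show ?thesis
    by (simp only: interchange[symmetric] sum_e)
qed

text \<open>A bounded holomorphic function has a primitive, and the mean along a vertical line is a
  difference of two values of that primitive. Moving the line changes these values by a bounded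
  amount, so the mean does not depend on the line in the limit.\<close>

lemma mean_shift:
  assumes "\<phi> holomorphic_on {s. \<alpha> < Re s}" "\<And>s. \<alpha> < Re s \<Longrightarrow> cmod (\<phi> s) \<le> K"
    and "\<alpha> < x" "\<alpha> < y" "l > 0"
  shows "((\<lambda>T. mean (\<lambda>t. \<phi> (Complex x t) * of_real l powr Complex x t) T
      - mean (\<lambda>t. \<phi> (Complex y t) * of_real l powr Complex y t) T) \<longlongrightarrow> 0) at_top"
proof -
  let ?S = "{s. \<alpha> < Re s}"
  let ?G = "\<lambda>s. \<phi> s * of_real l powr s"
  define B where "B = K * (l powr x + l powr y)"
  have "0 \<le> cmod (\<phi> (of_real x))" by simp
  also have "\<dots> \<le> K" using assms by simp
  finally have K: "0 \<le> K" .
  have op: "open ?S" by (simp add: open_halfspace_Re_gt)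
  have "?G holomorphic_on ?S"
    using assms(1,5) by (auto intro!: holomorphic_intros)
  then obtain F where F: "\<And>s. s \<in> ?S \<Longrightarrow> (F has_field_derivative ?G s) (at s within ?S)"
    using holomorphic_convex_primitive'[of ?S ?G] op convex_halfspace_Re_gt by blast
  have F': "(F has_field_derivative ?G s) (at s)" if "s \<in> ?S" for s
    using F[OF that] at_within_open[OF that op] by simp
  have line: "mean (\<lambda>t. ?G (Complex u t)) T
      = (F (Complex u T) - F (Complex u (- T))) / (\<i> * of_real (2 * T))"
    if "\<alpha> < u" "T > 0" for u T
  proof -
    have "((\<lambda>t. ?G (Complex u t)) has_integral (F (Complex u T) / \<i> - F (Complex u (- T)) / \<i>)) {- T..T}"
    proof (rule fundamental_theorem_of_calculus)
      fix t
      have "((\<lambda>t. Complex u t) has_vector_derivative \<i>) (at t within {- T..T})"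
        unfolding Complex_eq by (auto intro!: derivative_eq_intros)
      then have "((F \<circ> (\<lambda>t. Complex u t)) has_vector_derivative \<i> * ?G (Complex u t))
          (at t within {- T..T})"
        by (rule field_vector_diff_chain_within)
          (use that F' in \<open>auto intro: has_field_derivative_at_within\<close>)
      then have "((\<lambda>t. F (Complex u t) / \<i>) has_vector_derivative \<i> * ?G (Complex u t) / \<i>)
          (at t within {- T..T})"
        unfolding o_def by (rule has_vector_derivative_divide)
      then show "((\<lambda>t. F (Complex u t) / \<i>) has_vector_derivative ?G (Complex u t))
          (at t within {- T..T})" by simp
    qed (use that in simp)
    then show ?thesis
      unfolding mean_def
      by (simp only: integral_unique diff_divide_distrib[symmetric] divide_divide_eq_left)
  qed
  have move: "cmod (F (Complex x t) - F (Complex y t)) \<le> B * \<bar>x - y\<bar>" for t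
  proof -
    let ?C = "closed_segment (Complex y t) (Complex x t)"
    have seg: "Re s \<in> closed_segment y x" if "s \<in> ?C" for s
    proof -
      obtain u where "0 \<le> u" "u \<le> 1" "s = (1 - u) *\<^sub>R Complex y t + u *\<^sub>R Complex x t"
        using \<open>s \<in> ?C\<close> by (auto simp: closed_segment_def)
      then show ?thesis by (auto simp: closed_segment_def)
    qed
    have rng: "\<alpha> < Re s \<and> l powr Re s \<le> l powr x + l powr y" if "s \<in> ?C" for s
    proof -
      have r: "min x y \<le> Re s" "Re s \<le> max x y"
        using seg[OF that] by (auto simp: closed_segment_eq_real_ivl split: if_splits)
      have "l powr Re s \<le> max (l powr x) (l powr y)"
        using r assms(5) powr_mono[of "Re s" "max x y" l] powr_mono'[of "min x y" "Re s" l]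
        by (cases "1 \<le> l") (auto simp: max_def min_def split: if_splits)
      then show ?thesis using r assms(3,4) powr_ge_zero[of l x] powr_ge_zero[of l y] by linarith
    qed
    have "cmod (?G s) \<le> B" if "s \<in> ?C" for s
      unfolding B_def norm_mult using rng[OF that] assms(2,5) K
      by (intro mult_mono) (auto simp: norm_pos_powr)
    then have "cmod (F (Complex x t) - F (Complex y t)) \<le> B * cmod (Complex x t - Complex y t)"
      by (intro field_differentiable_bound[of ?C F ?G])
        (use rng F' in \<open>auto intro: has_field_derivative_at_within\<close>)
    then show ?thesis by (simp add: complex_diff cmod_def)
  qed
  show ?thesis
  proof (rule mean_tendsto_0)
    fix T :: real assume T: "T > 0"
    let ?D = "\<lambda>t. F (Complex x t) - F (Complex y t)"
    have "cmod (mean (\<lambda>t. ?G (Complex x t)) T - mean (\<lambda>t. ?G (Complex y t)) T)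
        = cmod (?D T - ?D (- T)) / (2 * T)"
      using line[OF assms(3) T] line[OF assms(4) T] T
      by (simp add: diff_divide_distrib[symmetric] norm_divide norm_mult algebra_simps)
    also have "\<dots> \<le> (B * \<bar>x - y\<bar> + B * \<bar>x - y\<bar>) / (2 * T)"
      using norm_triangle_ineq4[of "?D T" "?D (- T)"] move[of T] move[of "- T"] T
      by (intro divide_right_mono) auto
    finally show "cmod (mean (\<lambda>t. ?G (Complex x t)) T - mean (\<lambda>t. ?G (Complex y t)) T)
        \<le> (B * \<bar>x - y\<bar>) / T" by simp
  qed
qed

text \<open>The mean is computed far to the right, where the series converges absolutely, and moved to the given
  line, whether or not the series converges there.\<close>

lemma mean_coefficient:
  assumes "\<phi> holomorphic_on {s. \<alpha> < Re s}" "\<And>s. \<alpha> < Re s \<Longrightarrow> cmod (\<phi> s) \<le> K"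
    and "has_dirichlet_series \<phi> a" "\<alpha> < x" "l > 0"
  shows "((mean (\<lambda>t. \<phi> (Complex x t) * of_real l powr Complex x t))
    \<longlongrightarrow> (\<Sum>j. if real j = l then a j else 0)) at_top"
proof -
  obtain z where z: "converges_absolutely a z" "\<And>s. z \<le> Re s \<Longrightarrow> \<phi> s = dirichlet_value a s"
    using has_dirichlet_series_absolutely[OF assms(3)] by blast
  define y where "y = max z (\<alpha> + 1)"
  have y: "\<alpha> < y" "converges_absolutely a y" "\<And>t. \<phi> (Complex y t) = dirichlet_value a (Complex y t)"
    using z converges_absolutely_mono by (auto simp: y_def)
  have "((\<lambda>T. (mean (\<lambda>t. \<phi> (Complex x t) * of_real l powr Complex x t) T
      - mean (\<lambda>t. \<phi> (Complex y t) * of_real l powr Complex y t) T)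
      + mean (\<lambda>t. \<phi> (Complex y t) * of_real l powr Complex y t) T)
      \<longlongrightarrow> 0 + (\<Sum>j. if real j = l then a j else 0)) at_top"
    by (rule tendsto_add[OF mean_shift[OF assms(1,2,4) y(1) assms(5)]])
      (assumption, unfold y(3), rule mean_dirichlet_value[OF y(2) assms(5)])
  then show ?thesis by simp
qed

text \<open>The frequencies \<open>k / m\<close> arise when the product with a Dirichlet polynomial is averaged; they meet
  the frequencies of the series only if \<open>m\<close> divides \<open>k\<close>.\<close>

lemma suminf_at_quotient:
  assumes "m \<ge> 1"
  shows "(\<Sum>j. if real j = real k / real m then a j else 0)
    = (if m dvd k then a (k div m) else (0 :: complex))"
proof -
  have "real j = real k / real m \<longleftrightarrow> j * m = k" for j
    using assms by (simp add: field_simps flip: of_nat_mult)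
  moreover have "j * m = k \<longleftrightarrow> m dvd k \<and> j = k div m" for j
    using assms by auto
  ultimately show ?thesis
    using suminf_finite[of "{k div m}" "\<lambda>j. if real j = real k / real m then a j else 0"] by auto
qed

text \<open>The coefficients are recovered as mean values of the function.\<close>

lemma dirichlet_coefficients_unique:
  assumes "has_dirichlet_series f a" "has_dirichlet_series f b" "k \<ge> 1"
  shows "a k = b k"
proof -
  obtain x where x: "converges_absolutely a x" "\<And>s. x \<le> Re s \<Longrightarrow> f s = dirichlet_value a s"
    using has_dirichlet_series_absolutely[OF assms(1)] by blast
  obtain y where y: "converges_absolutely b y" "\<And>s. y \<le> Re s \<Longrightarrow> f s = dirichlet_value b s"
    using has_dirichlet_series_absolutely[OF assms(2)] by blast
  let ?z = "max x y"
  have "converges_absolutely a ?z" "converges_absolutely b ?z"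
    using x y converges_absolutely_mono by auto
  moreover have "dirichlet_value a (Complex ?z t) = dirichlet_value b (Complex ?z t)" for t
    using x(2)[of "Complex ?z t"] y(2)[of "Complex ?z t"] by simp
  ultimately have "(\<Sum>j. if real j = real k then a j else 0) = (\<Sum>j. if real j = real k then b j else 0)"
    using mean_dirichlet_value[of a ?z "real k"] mean_dirichlet_value[of b ?z "real k"] assms(3)
    by (intro tendsto_unique[OF trivial_limit_at_top_linorder]) auto
  then show ?thesis
    using suminf_at_quotient[of 1 k a] suminf_at_quotient[of 1 k b] by simp
qed

lemma mean_add:
  "continuous_on UNIV g \<Longrightarrow> continuous_on UNIV h \<Longrightarrow> mean (\<lambda>t. g t + h t) T = mean g T + mean h T"
  unfolding mean_def
  by (subst integral_add)
    (auto simp: add_divide_distrib intro: integrable_continuous_interval continuous_on_subset)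

lemma mean_cmult: "mean (\<lambda>t. c * g t) T = c * mean g T"
  unfolding mean_def by (simp add: integral_mult_right)

lemma mean_sum:
  "finite S \<Longrightarrow> (\<And>k. k \<in> S \<Longrightarrow> continuous_on UNIV (g k)) \<Longrightarrow>
    mean (\<lambda>t. \<Sum>k\<in>S. g k t) T = (\<Sum>k\<in>S. mean (g k) T)"
proof (induction S rule: finite_induct)
  case (insert k S)
  then show ?case by (simp add: mean_add continuous_on_sum)
qed (simp add: mean_def)

lemma Re_mean_nonneg:
  assumes "continuous_on UNIV h" "\<And>t. 0 \<le> Re (h t)" "T > 0"
  shows "0 \<le> Re (mean h T)"
proof -
  have i: "h integrable_on {- T..T}"
    using assms(1) continuous_on_subset integrable_continuous_interval by blast
  have "Re (integral {- T..T} h) = integral {- T..T} (\<lambda>t. Re (h t))"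
    using integral_linear[OF i bounded_linear_Re] by (simp add: o_def)
  moreover have "0 \<le> integral {- T..T} (\<lambda>t. Re (h t))"
    using assms(2) integrable_linear[OF i bounded_linear_Re]
    by (intro integral_nonneg) (auto simp: o_def)
  moreover have "mean h T = integral {- T..T} h / of_real (2 * T)" by (simp add: mean_def)
  ultimately show ?thesis
    using assms(3) by (simp only: Re_divide_of_real) simp
qed

lemma dirichlet_conv_commute: "dirichlet_conv a b j = dirichlet_conv b a j"
  unfolding dirichlet_conv_def
proof (cases "j = 0")
  case False
  then show "(\<Sum>d | d dvd j. a d * b (j div d)) = (\<Sum>d | d dvd j. b d * a (j div d))"
    by (intro sum.reindex_bij_witness[of _ "\<lambda>d. j div d" "\<lambda>d. j div d"])
      (auto simp: mult.commute div_dvd_iff_mult elim!: dvdE)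
qed simp

text \<open>On the line \<open>Re s = x\<close>, conjugation turns \<open>k powr (- s)\<close> into \<open>k powr s\<close> up to the
  factor \<open>k powr (- 2 * x)\<close>.\<close>

lemma mean_against_polynomial:
  assumes "finite S" "0 \<notin> S" "continuous_on UNIV h"
    and "\<And>k. k \<in> S \<Longrightarrow>
      ((mean (\<lambda>t. h t * of_nat k powr Complex x t)) \<longlongrightarrow> \<beta> k) at_top"
  shows "((mean (\<lambda>t. h t * cnj (\<Sum>k\<in>S. \<gamma> k * of_nat k powr (- Complex x t))))
    \<longlongrightarrow> (\<Sum>k\<in>S. \<beta> k * cnj (\<gamma> k) * of_real (real k powr (- 2 * x)))) at_top"
proof -
  have c: "cnj (of_nat k powr (- Complex x t)) = of_real (real k powr (- 2 * x)) * of_nat k powr Complex x t"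
    if "k \<in> S" for k t
  proof -
    have "k \<noteq> 0" using that assms(2) by metis
    then have "cnj (of_nat k powr (- Complex x t)) = exp (of_real (ln k) * (- cnj (Complex x t)))"
      by (simp add: powr_def Ln_of_nat exp_cnj mult.commute)
    also have "of_real (ln k) * (- cnj (Complex x t))
        = of_real (- 2 * x * ln k) + of_real (ln k) * Complex x t"
      by (simp add: complex_eq_iff algebra_simps)
    also have "exp \<dots> = of_real (real k powr (- 2 * x)) * of_nat k powr Complex x t"
      using \<open>k \<noteq> 0\<close> by (simp add: powr_def Ln_of_nat mult.commute exp_add[symmetric] flip: exp_of_real)
    finally show ?thesis .
  qed
  let ?g = "\<lambda>k t. cnj (\<gamma> k) * of_real (real k powr (- 2 * x)) * (h t * of_nat k powr Complex x t)"
  have "mean (\<lambda>t. h t * cnj (\<Sum>k\<in>S. \<gamma> k * of_nat k powr (- Complex x t)))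
      = (\<lambda>T. \<Sum>k\<in>S. mean (?g k) T)"
  proof
    fix T
    have "(\<lambda>t. h t * cnj (\<Sum>k\<in>S. \<gamma> k * of_nat k powr (- Complex x t))) = (\<lambda>t. \<Sum>k\<in>S. ?g k t)"
      using c by (auto simp: sum_distrib_left intro!: sum.cong)
    then show "mean (\<lambda>t. h t * cnj (\<Sum>k\<in>S. \<gamma> k * of_nat k powr (- Complex x t))) T
        = (\<Sum>k\<in>S. mean (?g k) T)"
      using assms(1,3) by (simp only:) (intro mean_sum continuous_intros)
  qed
  moreover have "((\<lambda>T. \<Sum>k\<in>S. mean (?g k) T)
      \<longlongrightarrow> (\<Sum>k\<in>S. cnj (\<gamma> k) * of_real (real k powr (- 2 * x)) * \<beta> k)) at_top"
    unfolding mean_cmult using assms(4) by (intro tendsto_sum tendsto_mult tendsto_const) auto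
  moreover have "(\<Sum>k\<in>S. cnj (\<gamma> k) * of_real (real k powr (- 2 * x)) * \<beta> k)
      = (\<Sum>k\<in>S. \<beta> k * cnj (\<gamma> k) * of_real (real k powr (- 2 * x)))"
    by (intro sum.cong refl) (simp only: mult_ac)
  ultimately show ?thesis by (simp only:)
qed

section \<open>Bessel's inequality for bounded functions\<close>

text \<open>Bessel's inequality in the mean: \<open>S\<close> is both the mean square of \<open>p\<close> and the mean of
  \<open>g * cnj p\<close>, so that \<open>p\<close> plays
  the part of an orthogonal projection of \<open>g\<close>.\<close>

lemma mean_square_bessel:
  fixes f g p :: "real \<Rightarrow> complex"
  assumes cont: "continuous_on UNIV f" "continuous_on UNIV g" "continuous_on UNIV p"
    and le: "\<And>t. cmod (g t) \<le> K * cmod (f t)"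
    and ff: "((mean (\<lambda>t. f t * cnj (f t))) \<longlongrightarrow> of_real R) at_top"
    and gp: "((mean (\<lambda>t. g t * cnj (p t))) \<longlongrightarrow> of_real S) at_top"
    and pp: "((mean (\<lambda>t. p t * cnj (p t))) \<longlongrightarrow> of_real S) at_top"
  shows "S \<le> K\<^sup>2 * R"
proof -
  \<comment> \<open>The real part of this integrand is \<open>K\<^sup>2 |f|\<^sup>2 + |p|\<^sup>2 - 2 Re (g * cnj p)\<close>,
    which is at least \<open>|g - p|\<^sup>2\<close>.\<close>
  let ?h = "\<lambda>t. of_real (K\<^sup>2) * (f t * cnj (f t)) + (p t * cnj (p t) + (- 2) * (g t * cnj (p t)))"
  have c: "continuous_on UNIV (\<lambda>t. of_real (K\<^sup>2) * (f t * cnj (f t)))"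
      "continuous_on UNIV (\<lambda>t. p t * cnj (p t))" "continuous_on UNIV (\<lambda>t. (- 2) * (g t * cnj (p t)))"
    by (intro continuous_intros cont)+
  have h: "0 \<le> Re (?h t)" for t
  proof -
    have "(cmod (g t))\<^sup>2 \<le> (K * cmod (f t))\<^sup>2"
      using le by (intro power_mono) auto
    moreover have "(cmod (g t - p t))\<^sup>2 = (cmod (g t))\<^sup>2 + (cmod (p t))\<^sup>2 - 2 * Re (g t * cnj (p t))"
      by (simp only: cmod_power2) (simp add: power2_eq_square algebra_simps)
    moreover have "Re (?h t) = (K * cmod (f t))\<^sup>2 + (cmod (p t))\<^sup>2 - 2 * Re (g t * cnj (p t))"
      by (simp only: cmod_power2 power_mult_distrib) (simp add: power2_eq_square algebra_simps)
    moreover have "0 \<le> (cmod (g t - p t))\<^sup>2" by simp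
    ultimately show ?thesis by linarith
  qed
  have "\<forall>\<^sub>F T in at_top. 0 \<le> Re (mean ?h T)"
    using eventually_gt_at_top[of 0]
    by eventually_elim (rule Re_mean_nonneg[OF continuous_on_add[OF c(1) continuous_on_add[OF c(2,3)]] h])
  moreover have "((\<lambda>T. Re (mean ?h T)) \<longlongrightarrow>
      Re (of_real (K\<^sup>2) * of_real R + (of_real S + (- 2) * of_real S))) at_top"
  proof -
    have "mean ?h = (\<lambda>T. of_real (K\<^sup>2) * mean (\<lambda>t. f t * cnj (f t)) T
        + (mean (\<lambda>t. p t * cnj (p t)) T + (- 2) * mean (\<lambda>t. g t * cnj (p t)) T))"
      by (intro ext)
        (simp only: mean_add[OF c(1) continuous_on_add[OF c(2,3)]] mean_add[OF c(2,3)] mean_cmult)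
    then show ?thesis
      by (simp only:) (intro tendsto_intros ff gp pp)
  qed
  ultimately have "0 \<le> Re (of_real (K\<^sup>2) * of_real R + (of_real S + (- 2) * of_real S))"
    by (intro tendsto_lowerbound[OF _ _ trivial_limit_at_top_linorder])
  then show ?thesis by (simp flip: of_real_power)
qed

lemma dirichlet_polynomial:
  assumes "finite S"
  shows "converges_absolutely (\<lambda>k. if k \<in> S then c k else 0) x"
    and "dirichlet_value (\<lambda>k. if k \<in> S then c k else 0) s = (\<Sum>k\<in>S. c k * of_nat k powr (- s))"
proof -
  show "converges_absolutely (\<lambda>k. if k \<in> S then c k else 0) x"
    unfolding converges_absolutely_def by (rule summable_finite[OF assms]) simp
  show "dirichlet_value (\<lambda>k. if k \<in> S then c k else 0) s = (\<Sum>k\<in>S. c k * of_nat k powr (- s))"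
    unfolding dirichlet_value_def by (subst suminf_finite[OF assms]) auto
qed

text \<open>On the line \<open>Re s = x\<close> the function \<open>\<phi> f\<close> is at most \<open>K\<close> times the Dirichlet
  polynomial \<open>f\<close>. Its mean square dominates, by Bessel's inequality, the coefficients of \<open>\<phi> f\<close> at the
  divisors of \<open>N\<close>, and these only involve coefficients of \<open>f\<close> at divisors of \<open>N\<close>.\<close>

lemma bessel_on_divisors_line:
  assumes hol: "\<phi> holomorphic_on {s. \<alpha> < Re s}" and bd: "\<And>s. \<alpha> < Re s \<Longrightarrow> cmod (\<phi> s) \<le> K"
    and ser: "has_dirichlet_series \<phi> a" and x: "\<alpha> < x" and N: "N \<ge> 1"
  shows "(\<Sum>j | j dvd N. (cmod (dirichlet_conv a c j))\<^sup>2 * real j powr (- 2 * x))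
    \<le> K\<^sup>2 * (\<Sum>j | j dvd N. (cmod (c j))\<^sup>2 * real j powr (- 2 * x))"
proof -
  let ?D = "{j. j dvd N}"
  \<comment> \<open>The coefficients that \<open>\<phi> f\<close> would have.\<close>
  define b where "b = dirichlet_conv a c"
  let ?poly = "\<lambda>c t. \<Sum>k\<in>?D. c k * of_nat k powr (- Complex x t)"
  let ?g = "\<lambda>t. \<phi> (Complex x t) * ?poly c t"
  let ?S = "\<lambda>c. \<Sum>k\<in>?D. (cmod (c k))\<^sup>2 * real k powr (- 2 * x)"
  have D: "finite ?D" "0 \<notin> ?D" using N by auto
  have pos: "k \<ge> 1" if "k \<in> ?D" for k using that D(2) by (cases k) auto
  have contp: "continuous_on UNIV (?poly c)" for c
    by (intro continuous_intros)
  have cont\<phi>: "continuous_on UNIV (\<lambda>t. \<phi> (Complex x t))"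
    by (rule continuous_on_compose2[OF holomorphic_on_imp_continuous_on[OF hol]])
      (use x in \<open>auto simp: Complex_eq intro!: continuous_intros\<close>)
  have sq: "(\<Sum>k\<in>?D. c k * cnj (c k) * of_real (real k powr (- 2 * x))) = of_real (?S c)" for c
    by (simp add: complex_norm_square flip: of_real_power)
  have poly: "((mean (\<lambda>t. ?poly c t * cnj (?poly c t))) \<longlongrightarrow> of_real (?S c)) at_top" for c
  proof -
    have "((mean (\<lambda>t. ?poly c t * of_nat k powr Complex x t)) \<longlongrightarrow> c k) at_top" if "k \<in> ?D" for k
      using mean_dirichlet_value[OF dirichlet_polynomial(1)[OF D(1), of c], of "real k" x,
          unfolded dirichlet_polynomial(2)[OF D(1)]] pos[OF that]
        suminf_at_quotient[of 1 k "\<lambda>k. if k \<in> ?D then c k else 0"] that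
      by simp
    from mean_against_polynomial[OF D contp this, of c] show ?thesis by (simp only: sq)
  qed
  have "((mean (\<lambda>t. ?g t * of_nat k powr Complex x t)) \<longlongrightarrow> b k) at_top" if k: "k \<in> ?D" for k
  proof -
    \<comment> \<open>The term \<open>c m * m powr (- s)\<close> of \<open>f\<close> turns the frequency \<open>k\<close> into \<open>k / m\<close>.\<close>
    let ?l = "\<lambda>m. real k / real m"
    have "?g t * of_nat k powr Complex x t
        = (\<Sum>m\<in>?D. c m * (\<phi> (Complex x t) * of_real (?l m) powr Complex x t))" for t
    proof -
      have q: "of_nat m powr (- Complex x t) * of_nat k powr Complex x t = of_real (?l m) powr Complex x t"
        if "m \<in> ?D" for m
      proof -
        have "complex_of_real r powr z = exp (z * of_real (ln r))" if "0 < r" for r z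
          using that by (simp add: powr_def Ln_of_real)
        then have "of_real (?l m) powr Complex x t = exp (Complex x t * of_real (ln (?l m)))"
          using pos[OF that] pos[OF k] by (metis divide_pos_pos of_nat_0_less_iff less_eq_Suc_le One_nat_def)
        also have "ln (?l m) = ln (real k) - ln (real m)"
          using pos[OF that] pos[OF k] by (simp add: ln_div)
        also have "exp (Complex x t * of_real (ln (real k) - ln (real m)))
            = of_nat m powr (- Complex x t) * of_nat k powr Complex x t"
          using pos[OF that] pos[OF k]
          by (simp add: powr_def Ln_of_nat exp_add[symmetric] algebra_simps)
        finally show ?thesis by (rule sym)
      qed
      have "?g t * of_nat k powr Complex x t = (\<Sum>m\<in>?D. c m * (\<phi> (Complex x t)
          * (of_nat m powr (- Complex x t) * of_nat k powr Complex x t)))"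
        unfolding sum_distrib_left sum_distrib_right by (intro sum.cong refl) (simp only: mult_ac)
      also have "\<dots> = (\<Sum>m\<in>?D. c m * (\<phi> (Complex x t) * of_real (?l m) powr Complex x t))"
        by (intro sum.cong refl) (simp only: q)
      finally show ?thesis .
    qed
    then have "mean (\<lambda>t. ?g t * of_nat k powr Complex x t) T
        = (\<Sum>m\<in>?D. mean (\<lambda>t. c m * (\<phi> (Complex x t) * of_real (?l m) powr Complex x t)) T)" for T
      by (simp only:) (rule mean_sum[OF D(1)], intro continuous_intros cont\<phi>)
    then have "mean (\<lambda>t. ?g t * of_nat k powr Complex x t)
        = (\<lambda>T. \<Sum>m\<in>?D. c m * mean (\<lambda>t. \<phi> (Complex x t) * of_real (?l m) powr Complex x t) T)"
      unfolding mean_cmult by (rule ext)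
    moreover have "((\<lambda>T. \<Sum>m\<in>?D. c m * mean (\<lambda>t. \<phi> (Complex x t) * of_real (?l m) powr Complex x t) T)
        \<longlongrightarrow> (\<Sum>m\<in>?D. c m * (if m dvd k then a (k div m) else 0))) at_top"
    proof (intro tendsto_sum tendsto_mult tendsto_const)
      fix m assume "m \<in> ?D"
      then have "0 < ?l m" using pos[OF \<open>m \<in> ?D\<close>] pos[OF k] by (intro divide_pos_pos) auto
      from mean_coefficient[OF hol bd ser x this] show "((mean (\<lambda>t. \<phi> (Complex x t) * of_real (?l m) powr Complex x t))
          \<longlongrightarrow> (if m dvd k then a (k div m) else 0)) at_top"
        using suminf_at_quotient[of m k a] pos[OF \<open>m \<in> ?D\<close>] by simp
    qed
    moreover have "(\<Sum>m\<in>?D. c m * (if m dvd k then a (k div m) else 0)) = b k"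
      unfolding b_def dirichlet_conv_commute[of a c]
      unfolding dirichlet_conv_def
      using k D by (intro sum.mono_neutral_cong_right) (auto intro: dvd_trans)
    ultimately show ?thesis by (simp only:)
  qed
  from mean_against_polynomial[OF D continuous_on_mult[OF cont\<phi> contp] this, of b]
  have cross: "((mean (\<lambda>t. ?g t * cnj (?poly b t))) \<longlongrightarrow> of_real (?S b)) at_top"
    by (simp only: sq)
  have "cmod (?g t) \<le> K * cmod (?poly c t)" for t
    unfolding norm_mult using bd[of "Complex x t"] x by (intro mult_right_mono) auto
  from mean_square_bessel[OF contp continuous_on_mult[OF cont\<phi> contp] contp this poly cross poly]
  show ?thesis by (simp add: b_def)
qed

text \<open>The limit \<open>x \<rightarrow> \<alpha>\<close>; here it matters that the sums are finite.\<close>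

lemma bessel_on_divisors:
  assumes "\<phi> holomorphic_on {s. \<alpha> < Re s}" "\<And>s. \<alpha> < Re s \<Longrightarrow> cmod (\<phi> s) \<le> K"
    and "has_dirichlet_series \<phi> a" "N \<ge> 1"
  shows "(\<Sum>j | j dvd N. (cmod (dirichlet_conv a c j))\<^sup>2 * real j powr (- 2 * \<alpha>))
    \<le> K\<^sup>2 * (\<Sum>j | j dvd N. (cmod (c j))\<^sup>2 * real j powr (- 2 * \<alpha>))"
proof (rule tendsto_le[OF trivial_limit_at_right_real])
  let ?S = "\<lambda>c x. \<Sum>j | j dvd N. (cmod (c j))\<^sup>2 * real j powr (- 2 * x)"
  have lim: "(?S c \<longlongrightarrow> ?S c \<alpha>) (at_right \<alpha>)" for c :: "nat \<Rightarrow> complex"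
  proof (intro tendsto_sum tendsto_mult tendsto_const)
    fix j assume "j \<in> {j. j dvd N}"
    then have "j \<noteq> 0" using assms(4) by auto
    then show "((\<lambda>x. real j powr (- 2 * x)) \<longlongrightarrow> real j powr (- 2 * \<alpha>)) (at_right \<alpha>)"
      by (intro tendsto_intros) auto
  qed
  show "((\<lambda>x. K\<^sup>2 * ?S c x) \<longlongrightarrow> K\<^sup>2 * ?S c \<alpha>) (at_right \<alpha>)"
    by (intro tendsto_mult tendsto_const lim)
  show "(?S (dirichlet_conv a c) \<longlongrightarrow> ?S (dirichlet_conv a c) \<alpha>) (at_right \<alpha>)"
    by (rule lim)
  show "\<forall>\<^sub>F x in at_right \<alpha>. ?S (dirichlet_conv a c) x \<le> K\<^sup>2 * ?S c x"
    using eventually_at_right_less[of \<alpha>]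
    by eventually_elim (rule bessel_on_divisors_line[OF assms(1,2,3) _ assms(4)])
qed

section \<open>Multiplicative weights and Abel summation\<close>

text \<open>With \<open>N = q ^ n * N'\<close> and \<open>N'\<close> prime to \<open>q\<close>, only the exponent of \<open>q\<close> is cut off.\<close>

lemma dvd_bounded_multiplicity:
  fixes q N :: nat
  assumes q: "prime q" and N: "N \<ge> 1" and i: "i \<le> multiplicity q N"
  shows "{j. j dvd N \<and> multiplicity q j \<le> i} = {j. j dvd q ^ i * (N div q ^ multiplicity q N)}"
proof -
  define n where "n = multiplicity q N"
  define N' where "N' = N div q ^ n"
  have NN: "N = q ^ n * N'"
    using multiplicity_dvd[of q N] by (simp add: N'_def n_def)
  have "N' \<noteq> 0" using NN N by (metis mult_0_right not_one_le_zero)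
  have "N \<noteq> 0" "\<not> is_unit q" using N q not_prime_unit by auto
  then have nq: "\<not> q dvd N'"
    using multiplicity_decompose[of N q] by (simp add: N'_def n_def)
  have "j dvd q ^ i * N'" if "j dvd N" "multiplicity q j \<le> i" for j
  proof -
    have "j \<noteq> 0" using that(1) N by auto
    then obtain k where k: "j = q ^ multiplicity q j * k" "\<not> q dvd k"
      using multiplicity_decompose'[of j q] q by (metis not_prime_unit)
    have "coprime q k" using q k(2) by (rule prime_imp_coprime)
    then have "coprime k (q ^ n)" by (simp add: coprime_commute)
    moreover have "k dvd q ^ n * N'"
      using that(1) k(1) NN by (metis dvd_mult_right)
    ultimately have "k dvd N'" by (simp add: coprime_dvd_mult_right_iff)
    then show ?thesis
      using k(1) mult_dvd_mono[OF le_imp_power_dvd[OF that(2), of q]] by metis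
  qed
  moreover have "j dvd N \<and> multiplicity q j \<le> i" if "j dvd q ^ i * N'" for j
  proof
    have "q ^ i * N' dvd N"
      unfolding NN using i by (intro mult_dvd_mono le_imp_power_dvd) (simp_all add: n_def)
    then show "j dvd N" using that dvd_trans by blast
    have "multiplicity q j \<le> multiplicity q (q ^ i * N')"
      using that q \<open>N' \<noteq> 0\<close> by (intro dvd_imp_multiplicity_le) auto
    also have "\<dots> = i"
      using q nq \<open>N' \<noteq> 0\<close> by (simp add: prime_elem_multiplicity_mult_distrib not_dvd_imp_multiplicity_0)
    finally show "multiplicity q j \<le> i" .
  qed
  ultimately show ?thesis by (auto simp: N'_def n_def)
qed

text \<open>Abel summation in the exponent of a single prime \<open>q\<close>: a nonincreasing weight \<open>h\<close> is a
  nonnegative combination of the indicators of \<open>{0..i}\<close>, and cutting the exponent of \<open>q\<close> off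
  at \<open>i\<close> turns the divisors of \<open>N\<close> into the divisors of a smaller number.\<close>

lemma divisor_sums_weight_prime:
  fixes h :: "nat \<Rightarrow> real" and q :: nat
  assumes X: "\<And>N. N \<ge> 1 \<Longrightarrow> 0 \<le> (\<Sum>j | j dvd N. X j)"
    and q: "prime q" and h: "\<And>i. 0 \<le> h i" "\<And>i. h (Suc i) \<le> h i" and N: "N \<ge> 1"
  shows "0 \<le> (\<Sum>j | j dvd N. X j * h (multiplicity q j))"
proof -
  define n where "n = multiplicity q N"
  define d where "d i = (if i < n then h i - h (Suc i) else h n)" for i
  have d: "0 \<le> d i" for i using h by (simp add: d_def)
  have fin: "finite {j. j dvd N}" using N by auto
  have tele: "h v = (\<Sum>i = v..n. d i)" if "v \<le> n" for v
    using that
  proof (induction rule: inc_induct)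
    case (step v)
    then have "(\<Sum>i = v..n. d i) = d v + (\<Sum>i = Suc v..n. d i)"
      by (simp add: sum.atLeast_Suc_atMost)
    then show ?case using step by (simp add: d_def)
  qed (simp add: d_def)
  have "h (multiplicity q j) = (\<Sum>i\<le>n. if multiplicity q j \<le> i then d i else 0)" if "j dvd N" for j
  proof -
    have "multiplicity q j \<le> n"
      unfolding n_def using that N q by (intro dvd_imp_multiplicity_le) auto
    then show ?thesis
      unfolding tele[OF \<open>multiplicity q j \<le> n\<close>] by (intro sum.mono_neutral_cong_left) auto
  qed
  then have "(\<Sum>j | j dvd N. X j * h (multiplicity q j))
      = (\<Sum>j | j dvd N. \<Sum>i\<le>n. X j * (if multiplicity q j \<le> i then d i else 0))"
    by (simp add: sum_distrib_left)
  also have "\<dots> = (\<Sum>i\<le>n. \<Sum>j | j dvd N. X j * (if multiplicity q j \<le> i then d i else 0))"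
    by (rule sum.swap)
  also have "\<dots> = (\<Sum>i\<le>n. d i * (\<Sum>j | j dvd q ^ i * (N div q ^ n). X j))"
  proof (rule sum.cong[OF refl])
    fix i assume "i \<in> {..n}"
    then have "{j. j dvd q ^ i * (N div q ^ n)} = {j. j dvd N \<and> multiplicity q j \<le> i}"
      unfolding n_def using dvd_bounded_multiplicity[OF q N] by simp
    moreover have "(\<Sum>j | j dvd N. X j * (if multiplicity q j \<le> i then d i else 0))
        = (\<Sum>j | j dvd N \<and> multiplicity q j \<le> i. d i * X j)"
      by (rule sum.mono_neutral_cong_right) (use fin in auto)
    ultimately show "(\<Sum>j | j dvd N. X j * (if multiplicity q j \<le> i then d i else 0))
        = d i * (\<Sum>j | j dvd q ^ i * (N div q ^ n). X j)"
      by (simp add: sum_distrib_left)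
  qed
  finally have "(\<Sum>j | j dvd N. X j * h (multiplicity q j))
      = (\<Sum>i\<le>n. d i * (\<Sum>j | j dvd q ^ i * (N div q ^ n). X j))" .
  moreover have "\<dots> \<ge> 0"
  proof (rule sum_nonneg, rule mult_nonneg_nonneg[OF d X])
    fix i
    have "N div q ^ n > 0"
      using multiplicity_dvd[of q N] N by (simp add: n_def div_greater_zero_iff dvd_imp_le prime_gt_0_nat q)
    then show "1 \<le> q ^ i * (N div q ^ n)"
      using prime_gt_0_nat[OF q] by (simp add: Suc_le_eq)
  qed
  ultimately show ?thesis by simp
qed

text \<open>The step for one prime preserves the hypothesis that all divisor sums are nonnegative, so the primes
  can be treated one after the other.\<close>

lemma divisor_sums_weight_primes:
  fixes h :: "nat \<Rightarrow> nat \<Rightarrow> real"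
  assumes "finite P" "\<And>p. p \<in> P \<Longrightarrow> prime p"
    and X: "\<And>N. N \<ge> 1 \<Longrightarrow> 0 \<le> (\<Sum>j | j dvd N. X j)"
    and h: "\<And>p i. 0 \<le> h p i" "\<And>p i. p \<in> P \<Longrightarrow> h p (Suc i) \<le> h p i"
  shows "N \<ge> 1 \<Longrightarrow> 0 \<le> (\<Sum>j | j dvd N. X j * (\<Prod>p\<in>P. h p (multiplicity p j)))"
  using assms(1,2) h(2)
proof (induction P arbitrary: N rule: finite_induct)
  case (insert q P)
  have "0 \<le> (\<Sum>j | j dvd N. (X j * (\<Prod>p\<in>P. h p (multiplicity p j))) * h q (multiplicity q j))"
    by (rule divisor_sums_weight_prime) (use insert h(1) in auto)
  then show ?case
    using insert.hyps by (simp add: mult_ac)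
qed (use X in simp)

lemma multiplicative_prime_powers:
  fixes r :: "nat \<Rightarrow> real"
  assumes mult: "\<And>m n. m \<ge> 1 \<Longrightarrow> n \<ge> 1 \<Longrightarrow> coprime m n \<Longrightarrow> r (m * n) = r m * r n"
    and r1: "r 1 = 1" and j: "j dvd N" and N: "N \<ge> 1"
  shows "r j = (\<Prod>p\<in>prime_factors N. r (p ^ multiplicity p j))"
proof -
  have prod: "r (\<Prod>p\<in>P. p ^ e p) = (\<Prod>p\<in>P. r (p ^ e p))"
    if "finite P" "\<And>p. p \<in> P \<Longrightarrow> prime p" for P and e :: "nat \<Rightarrow> nat"
    using that
  proof (induction P rule: finite_induct)
    case (insert q P)
    have "coprime (q ^ e q) (\<Prod>p\<in>P. p ^ e p)"
      using insert.hyps insert.prems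
      by (intro prod_coprime_right) (auto intro!: coprime_power_left_iff[THEN iffD2]
          coprime_power_right_iff[THEN iffD2] primes_coprime)
    moreover have "1 \<le> q ^ e q" "1 \<le> (\<Prod>p\<in>P. p ^ e p)"
      using insert.prems prime_gt_0_nat by (auto simp: Suc_le_eq intro!: prod_pos)
    ultimately show ?case using insert mult by simp
  qed (use r1 in simp)
  have "j = (\<Prod>p\<in>prime_factors N. p ^ multiplicity p j)"
  proof -
    have "j \<noteq> 0" using j N by auto
    then have "j = (\<Prod>p\<in>prime_factors j. p ^ multiplicity p j)"
      by (simp add: prime_factorization_nat)
    also have "\<dots> = (\<Prod>p\<in>prime_factors N. p ^ multiplicity p j)"
    proof (rule prod.mono_neutral_left)
      show "prime_factors j \<subseteq> prime_factors N"
        using j N by (intro dvd_prime_factors) auto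
      show "\<forall>p\<in>prime_factors N - prime_factors j. p ^ multiplicity p j = 1"
        using \<open>j \<noteq> 0\<close> by (auto simp: prime_factors_multiplicity)
    qed simp
    finally show ?thesis .
  qed
  then have "r j = r (\<Prod>p\<in>prime_factors N. p ^ multiplicity p j)"
    by (rule arg_cong)
  also have "\<dots> = (\<Prod>p\<in>prime_factors N. r (p ^ multiplicity p j))"
    by (rule prod) auto
  finally show ?thesis .
qed

text \<open>Below, \<open>X\<close> is the difference of the two sides of an inequality that holds, summed over the divisors of
  any \<open>N\<close>, for a simple weight; the lemma makes it available for the weight times \<open>r\<close>.\<close>

lemma divisor_sums_weight:
  fixes r :: "nat \<Rightarrow> real"
  assumes X: "\<And>N. N \<ge> 1 \<Longrightarrow> 0 \<le> (\<Sum>j | j dvd N. X j)"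
    and mult: "\<And>m n. m \<ge> 1 \<Longrightarrow> n \<ge> 1 \<Longrightarrow> coprime m n \<Longrightarrow> r (m * n) = r m * r n"
    and r: "r 1 = 1" "\<And>n. 0 \<le> r n"
    and dec: "\<And>p i. prime p \<Longrightarrow> r (p ^ Suc i) \<le> r (p ^ i)"
    and N: "N \<ge> 1"
  shows "0 \<le> (\<Sum>j | j dvd N. X j * r j)"
proof -
  have "0 \<le> (\<Sum>j | j dvd N. X j * (\<Prod>p\<in>prime_factors N. r (p ^ multiplicity p j)))"
    by (rule divisor_sums_weight_primes[OF _ _ X])
      (use r(2) dec N in \<open>auto simp: in_prime_factors_imp_prime\<close>)
  then show ?thesis
    using multiplicative_prime_powers[OF mult r(1) _ N] by simp
qed

section \<open>Weighted square-summable sequences\<close>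

definition ell2 :: "(nat \<Rightarrow> real) \<Rightarrow> (nat \<Rightarrow> complex) set" where
  "ell2 w = {c. c 0 = 0 \<and> summable (\<lambda>j. (cmod (c j))\<^sup>2 / w j)}"

definition ell2_sq :: "(nat \<Rightarrow> real) \<Rightarrow> (nat \<Rightarrow> complex) \<Rightarrow> real" where
  "ell2_sq w c = (\<Sum>j. (cmod (c j))\<^sup>2 / w j)"

lemma norm_add_sq_le: "(cmod (x + y))\<^sup>2 \<le> 2 * (cmod x)\<^sup>2 + 2 * (cmod y)\<^sup>2"
proof -
  have "(cmod (x + y))\<^sup>2 \<le> (cmod x + cmod y)\<^sup>2"
    by (intro power_mono norm_triangle_ineq) simp
  also have "\<dots> \<le> 2 * (cmod x)\<^sup>2 + 2 * (cmod y)\<^sup>2"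
    using sum_squares_bound[of "cmod x" "cmod y"] by (simp add: power2_sum)
  finally show ?thesis .
qed

locale positive_weight =
  fixes w :: "nat \<Rightarrow> real"
  assumes pos: "j \<ge> 1 \<Longrightarrow> w j > 0"
begin

lemma ell2_term_nonneg: "c \<in> ell2 w \<Longrightarrow> 0 \<le> (cmod (c j))\<^sup>2 / w j"
  using pos[of j] by (cases "j = 0") (auto simp: ell2_def)

lemma ell2_summable: "c \<in> ell2 w \<Longrightarrow> summable (\<lambda>j. (cmod (c j))\<^sup>2 / w j)"
  by (simp add: ell2_def)

lemma ell2_sq_nonneg: "c \<in> ell2 w \<Longrightarrow> 0 \<le> ell2_sq w c"
  unfolding ell2_sq_def by (rule suminf_nonneg[OF ell2_summable ell2_term_nonneg])

lemma ell2_partial_sum_le: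
  "c \<in> ell2 w \<Longrightarrow> finite S \<Longrightarrow> (\<Sum>j\<in>S. (cmod (c j))\<^sup>2 / w j) \<le> ell2_sq w c"
  unfolding ell2_sq_def by (rule sum_le_suminf[OF ell2_summable]) (auto simp: ell2_term_nonneg)

lemma ell2_dominated:
  assumes "c \<in> ell2 w" "\<And>j. cmod (b j) \<le> cmod (c j)"
  shows "b \<in> ell2 w" "ell2_sq w b \<le> ell2_sq w c"
proof -
  have le: "(cmod (b j))\<^sup>2 / w j \<le> (cmod (c j))\<^sup>2 / w j" and ge: "0 \<le> (cmod (b j))\<^sup>2 / w j" for j
    using assms(1) assms(2)[of j] pos[of j]
    by (cases "j = 0"; auto simp: ell2_def intro!: divide_right_mono power_mono)+
  have "summable (\<lambda>j. (cmod (b j))\<^sup>2 / w j)"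
    by (rule summable_comparison_test'[OF ell2_summable[OF assms(1)], of 0])
      (unfold real_norm_def abs_of_nonneg[OF ge], rule le)
  then show "b \<in> ell2 w"
    using assms(1) assms(2)[of 0] by (simp add: ell2_def)
  then show "ell2_sq w b \<le> ell2_sq w c"
    unfolding ell2_sq_def using assms(1) by (intro suminf_le le ell2_summable)
qed

lemma ell2_add:
  assumes "b \<in> ell2 w" "c \<in> ell2 w"
  shows "(\<lambda>j. b j + c j) \<in> ell2 w" "ell2_sq w (\<lambda>j. b j + c j) \<le> 2 * ell2_sq w b + 2 * ell2_sq w c"
proof -
  have le: "(cmod (b j + c j))\<^sup>2 / w j \<le> 2 * ((cmod (b j))\<^sup>2 / w j) + 2 * ((cmod (c j))\<^sup>2 / w j)"
    and ge: "0 \<le> (cmod (b j + c j))\<^sup>2 / w j" for j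
    using assms pos[of j] norm_add_sq_le[of "b j" "c j"]
    by (cases "j = 0"; auto simp: ell2_def field_simps)+
  have s: "summable (\<lambda>j. 2 * ((cmod (b j))\<^sup>2 / w j) + 2 * ((cmod (c j))\<^sup>2 / w j))"
    using assms by (intro summable_add summable_mult ell2_summable)
  have "summable (\<lambda>j. (cmod (b j + c j))\<^sup>2 / w j)"
    by (rule summable_comparison_test'[OF s, of 0])
      (unfold real_norm_def abs_of_nonneg[OF ge], rule le)
  then show mem: "(\<lambda>j. b j + c j) \<in> ell2 w" using assms by (simp add: ell2_def)
  have "ell2_sq w (\<lambda>j. b j + c j) \<le> (\<Sum>j. 2 * ((cmod (b j))\<^sup>2 / w j) + 2 * ((cmod (c j))\<^sup>2 / w j))"
    unfolding ell2_sq_def using s ell2_summable[OF mem] le by (intro suminf_le)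
  also have "\<dots> = 2 * ell2_sq w b + 2 * ell2_sq w c"
    unfolding ell2_sq_def
    by (simp only: suminf_add[symmetric] suminf_mult summable_mult ell2_summable assms)
  finally show "ell2_sq w (\<lambda>j. b j + c j) \<le> 2 * ell2_sq w b + 2 * ell2_sq w c" .
qed

lemma ell2_scale:
  assumes "c \<in> ell2 w"
  shows "(\<lambda>j. z * c j) \<in> ell2 w" "ell2_sq w (\<lambda>j. z * c j) = (cmod z)\<^sup>2 * ell2_sq w c"
proof -
  have eq: "(cmod (z * c j))\<^sup>2 / w j = (cmod z)\<^sup>2 * ((cmod (c j))\<^sup>2 / w j)" for j
    by (simp add: norm_mult power_mult_distrib)
  show "(\<lambda>j. z * c j) \<in> ell2 w"
    using assms summable_mult[OF ell2_summable[OF assms]] unfolding ell2_def mem_Collect_eq eq by simp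
  show "ell2_sq w (\<lambda>j. z * c j) = (cmod z)\<^sup>2 * ell2_sq w c"
    unfolding ell2_sq_def eq by (rule suminf_mult[OF ell2_summable[OF assms]])
qed

lemma ell2_add_disjoint:
  assumes "b \<in> ell2 w" "c \<in> ell2 w" "\<And>j. b j = 0 \<or> c j = 0"
  shows "ell2_sq w (\<lambda>j. b j + c j) = ell2_sq w b + ell2_sq w c"
proof -
  have "(cmod (b j + c j))\<^sup>2 / w j = (cmod (b j))\<^sup>2 / w j + (cmod (c j))\<^sup>2 / w j" for j
    using assms(3)[of j] by auto
  then show ?thesis
    unfolding ell2_sq_def using assms by (simp add: suminf_add ell2_summable)
qed

lemma ell2_finite_support:
  assumes "c 0 = 0" "\<And>j. j > M \<Longrightarrow> c j = 0"
  shows "c \<in> ell2 w" "ell2_sq w c = (\<Sum>j\<le>M. (cmod (c j))\<^sup>2 / w j)"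
proof -
  have z: "(cmod (c j))\<^sup>2 / w j = 0" if "j \<notin> {..M}" for j using assms(2)[of j] that by simp
  show "c \<in> ell2 w"
    using assms(1) summable_finite[OF finite_atMost z] by (simp add: ell2_def)
  show "ell2_sq w c = (\<Sum>j\<le>M. (cmod (c j))\<^sup>2 / w j)"
    unfolding ell2_sq_def by (rule suminf_finite) (use z in auto)
qed

lemma ell2_sq_eq_0: "c \<in> ell2 w \<Longrightarrow> ell2_sq w c = 0 \<Longrightarrow> c j = 0"
proof -
  assume c: "c \<in> ell2 w" "ell2_sq w c = 0"
  then have "(cmod (c j))\<^sup>2 / w j \<le> 0"
    using ell2_partial_sum_le[OF c(1), of "{j}"] by simp
  then show "c j = 0"
    using c(1) pos[of j] by (cases "j = 0") (auto simp: ell2_def divide_le_0_iff)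
qed

lemma ell2I_bounded:
  assumes "c 0 = 0" "\<And>n. (\<Sum>j<n. (cmod (c j))\<^sup>2 / w j) \<le> B"
  shows "c \<in> ell2 w" "ell2_sq w c \<le> B"
proof -
  have nn: "0 \<le> (cmod (c j))\<^sup>2 / w j" for j
    using assms(1) pos[of j] by (cases "j = 0") auto
  show "c \<in> ell2 w"
    unfolding ell2_def using assms summableI_nonneg_bounded[OF nn assms(2)] by simp
  then show "ell2_sq w c \<le> B"
    unfolding ell2_sq_def using assms(2) by (intro suminf_le_const ell2_summable)
qed

text \<open>An instance of the closed graph theorem, proved with a gliding hump. If the operator were
  unbounded, it would be unbounded on sequences supported beyond any given index, as it is bounded
  on finitely many coordinates. Small blocks with disjoint supports and large images then add up to a
  sequence in the space with an unbounded image; by triangularity the later blocks do not touch what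
  the earlier ones have achieved.\<close>

lemma triangular_operator_bounded:
  fixes A :: "(nat \<Rightarrow> complex) \<Rightarrow> nat \<Rightarrow> complex"
  assumes add: "\<And>f g. A (\<lambda>j. f j + g j) = (\<lambda>j. A f j + A g j)"
    and scale: "\<And>z f. A (\<lambda>j. z * f j) = (\<lambda>j. z * A f j)"
    and triangular: "\<And>f g j. (\<And>i. i \<le> j \<Longrightarrow> f i = g i) \<Longrightarrow> A f j = A g j"
    and maps: "\<And>f. f \<in> ell2 w \<Longrightarrow> A f \<in> ell2 w"
  obtains C where "\<And>f. f \<in> ell2 w \<Longrightarrow> ell2_sq w (A f) \<le> C * ell2_sq w f"
proof (rule ccontr)
  assume "\<not> thesis"
  then have unbounded: "\<exists>f\<in>ell2 w. ell2_sq w (A f) > C * ell2_sq w f" for C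
    using that by (meson not_le)
  let ?cut = "\<lambda>N (f :: nat \<Rightarrow> complex) j. if j \<le> N then f j else 0"
  let ?S = "\<lambda>M f. \<Sum>j\<le>M. (cmod (f j))\<^sup>2 / w j"
  have cut: "?cut N f \<in> ell2 w" "ell2_sq w (?cut N f) \<le> ell2_sq w f" if "f \<in> ell2 w" for N f
    by (rule ell2_dominated[OF that]; simp)+
  have head: "\<exists>D. \<forall>f\<in>ell2 w. ell2_sq w (A (?cut N f)) \<le> D * ell2_sq w f" for N
  proof (induction N)
    case 0
    have "ell2_sq w (A (?cut 0 f)) \<le> 0 * ell2_sq w f" if "f \<in> ell2 w" for f
    proof -
      have "?cut 0 f = (\<lambda>j. 0 * f j)" using that by (auto simp: ell2_def)
      then show ?thesis using scale[of 0 f] by (simp add: ell2_sq_def)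
    qed
    then show ?case by blast
  next
    case (Suc N)
    then obtain D where D: "\<And>f. f \<in> ell2 w \<Longrightarrow> ell2_sq w (A (?cut N f)) \<le> D * ell2_sq w f" by blast
    let ?e = "\<lambda>j. if j = Suc N then 1 else 0 :: complex"
    have e: "?e \<in> ell2 w" by (rule ell2_finite_support(1)[of _ "Suc N"]) auto
    have "ell2_sq w (A (?cut (Suc N) f)) \<le> (2 * D + 2 * (w (Suc N) * ell2_sq w (A ?e))) * ell2_sq w f"
      if f: "f \<in> ell2 w" for f
    proof -
      have "?cut (Suc N) f = (\<lambda>j. ?cut N f j + f (Suc N) * ?e j)"
        by (simp add: fun_eq_iff le_Suc_eq)
      then have "A (?cut (Suc N) f) = (\<lambda>j. A (?cut N f) j + f (Suc N) * A ?e j)"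
        by (simp only: add scale)
      then have "ell2_sq w (A (?cut (Suc N) f))
          \<le> 2 * ell2_sq w (A (?cut N f)) + 2 * ((cmod (f (Suc N)))\<^sup>2 * ell2_sq w (A ?e))"
        using ell2_add(2)[OF maps[OF cut(1)[OF f]] ell2_scale(1)[OF maps[OF e]]]
          ell2_scale(2)[OF maps[OF e]] by simp
      moreover have "(cmod (f (Suc N)))\<^sup>2 * ell2_sq w (A ?e) \<le> (w (Suc N) * ell2_sq w f) * ell2_sq w (A ?e)"
        using ell2_partial_sum_le[OF f, of "{Suc N}"] pos[of "Suc N"]
        by (intro mult_right_mono ell2_sq_nonneg maps e) (simp add: field_simps)
      ultimately show ?thesis using D[OF f] by (simp add: algebra_simps)
    qed
    then show ?case by blast
  qed
  have hump: "\<exists>M g. M > N \<and> g \<in> ell2 w \<and> (\<forall>j\<le>N. g j = 0) \<and> (\<forall>j>M. g j = 0)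
      \<and> ell2_sq w g = \<epsilon> \<and> B \<le> ?S M (A g)" if "\<epsilon> > 0" "B > 0" for N \<epsilon> B
  proof -
    obtain D where D: "\<And>f. f \<in> ell2 w \<Longrightarrow> ell2_sq w (A (?cut N f)) \<le> D * ell2_sq w f"
      using head by blast
    obtain f where f: "f \<in> ell2 w" "ell2_sq w (A f) > (2 * (B / \<epsilon>) + 2 * D) * ell2_sq w f"
      using unbounded by blast
    define t where "t j = (if j \<le> N then 0 else f j)" for j
    have t: "t \<in> ell2 w" "ell2_sq w t \<le> ell2_sq w f"
      by (rule ell2_dominated[OF f(1)]; simp add: t_def)+
    have "f = (\<lambda>j. t j + ?cut N f j)" by (auto simp: t_def)
    then have "A f = A (\<lambda>j. t j + ?cut N f j)" by (rule arg_cong)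
    then have "A f = (\<lambda>j. A t j + A (?cut N f) j)" by (simp only: add)
    then have "ell2_sq w (A f) \<le> 2 * ell2_sq w (A t) + 2 * ell2_sq w (A (?cut N f))"
      using ell2_add(2)[OF maps[OF t(1)] maps[OF cut(1)[OF f(1)]]] by (simp only:)
    then have "2 * (B / \<epsilon> * ell2_sq w f) < 2 * ell2_sq w (A t)"
      using f(2) D[OF f(1)] by (simp add: algebra_simps)
    moreover have "B / \<epsilon> * ell2_sq w t \<le> B / \<epsilon> * ell2_sq w f"
      using t(2) that by (intro mult_left_mono) auto
    ultimately have At: "B / \<epsilon> * ell2_sq w t < ell2_sq w (A t)" by linarith
    have "(\<lambda>M. ?S M (A t)) \<longlonglongrightarrow> ell2_sq w (A t)"
      unfolding ell2_sq_def using ell2_summable[OF maps[OF t(1)]] by (rule summable_LIMSEQ')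
    then have "\<forall>\<^sub>F M in sequentially. N < M \<and> B / \<epsilon> * ell2_sq w t < ?S M (A t)"
      using At by (intro eventually_conj eventually_gt_at_top order_tendstoD(1))
    then obtain M where M: "M > N" "B / \<epsilon> * ell2_sq w t < ?S M (A t)"
      using eventually_happens'[OF sequentially_bot] by blast
    define g where "g = ?cut M t"
    have g: "g \<in> ell2 w" "ell2_sq w g \<le> ell2_sq w t" using cut[OF t(1)] by (auto simp: g_def)
    have "?S M (A g) = ?S M (A t)"
      by (intro sum.cong refl arg_cong2[where f = "(/)"] arg_cong[where f = "\<lambda>z. (cmod z)\<^sup>2"] triangular)
        (auto simp: g_def)
    moreover have "B / \<epsilon> * ell2_sq w g \<le> B / \<epsilon> * ell2_sq w t"
      using g(2) that by (intro mult_left_mono) auto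
    ultimately have Ag: "B / \<epsilon> * ell2_sq w g < ?S M (A g)" using M(2) by linarith
    have "ell2_sq w g \<noteq> 0"
    proof
      assume "ell2_sq w g = 0"
      then have "g = (\<lambda>j. 0 * g j)" using ell2_sq_eq_0[OF g(1)] by auto
      then have "A g = (\<lambda>j. 0)" using scale[of 0 g] by simp
      then show False using Ag \<open>ell2_sq w g = 0\<close> by simp
    qed
    then have gpos: "ell2_sq w g > 0" using ell2_sq_nonneg[OF g(1)] by simp
    define z where "z = complex_of_real (sqrt (\<epsilon> / ell2_sq w g))"
    have z: "(cmod z)\<^sup>2 = \<epsilon> / ell2_sq w g" using that gpos by (simp add: z_def)
    have "?S M (A (\<lambda>j. z * g j)) = (cmod z)\<^sup>2 * ?S M (A g)"
      by (simp add: scale norm_mult power_mult_distrib sum_distrib_left)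
    moreover have "(cmod z)\<^sup>2 * (B / \<epsilon> * ell2_sq w g) \<le> (cmod z)\<^sup>2 * ?S M (A g)"
      using Ag by (intro mult_left_mono) auto
    moreover have "(cmod z)\<^sup>2 * (B / \<epsilon> * ell2_sq w g) = B"
      unfolding z using gpos that by simp
    ultimately have "B \<le> ?S M (A (\<lambda>j. z * g j))" by simp
    moreover have "ell2_sq w (\<lambda>j. z * g j) = \<epsilon>"
      using ell2_scale(2)[OF g(1), of z] z gpos by simp
    ultimately show ?thesis
      using M(1) ell2_scale(1)[OF g(1), of z]
      by (intro exI[of _ M] exI[of _ "\<lambda>j. z * g j"]) (auto simp: g_def t_def)
  qed
  let ?P = "\<lambda>k (M, f). f \<in> ell2 w \<and> (\<forall>j>M. f j = 0) \<and> real k \<le> ?S M (A f)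
    \<and> ell2_sq w f \<le> 2 - (1 / 2) ^ k"
  let ?Q = "\<lambda>(k :: nat) (M :: nat, f :: nat \<Rightarrow> complex) (M', f'). M < M' \<and> (\<forall>j\<le>M. f' j = f j)"
  \<comment> \<open>Each step appends a hump, of squared norm \<open>(1 / 2) ^ Suc k\<close>, to the current finite sequence.\<close>
  have "\<exists>s. \<forall>k. ?P k (s k) \<and> ?Q k (s k) (s (Suc k))"
  proof (rule dependent_nat_choice)
    have "(\<lambda>j. 0) \<in> ell2 w" "ell2_sq w (\<lambda>j. 0) = 0" by (auto simp: ell2_def ell2_sq_def)
    moreover have "0 \<le> ?S 0 (A (\<lambda>j. 0))"
      using ell2_term_nonneg[OF maps] calculation(1) by (intro sum_nonneg) blast
    ultimately show "\<exists>x. ?P 0 x" by (intro exI[of _ "(0, \<lambda>j. 0)"]) auto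
  next
    fix x k assume "?P k x"
    then obtain M f where x: "x = (M, f)" and f: "f \<in> ell2 w" "\<forall>j>M. f j = 0"
      "ell2_sq w f \<le> 2 - (1 / 2) ^ k" by (cases x) auto
    \<comment> \<open>The hump has to outweigh the image of the previous blocks, which costs a factor 2.\<close>
    let ?B = "2 * (real (Suc k) + ell2_sq w (A f))"
    have "?B > 0" using ell2_sq_nonneg[OF maps[OF f(1)]] by simp
    then obtain M' g where g: "M' > M" "g \<in> ell2 w" "\<forall>j\<le>M. g j = 0" "\<forall>j>M'. g j = 0"
      "ell2_sq w g = (1 / 2) ^ Suc k" "?B \<le> ?S M' (A g)"
      using hump[of "(1 / 2) ^ Suc k" ?B M] by auto
    let ?f' = "\<lambda>j. f j + g j"
    have "ell2_sq w ?f' = ell2_sq w f + ell2_sq w g"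
      by (rule ell2_add_disjoint[OF f(1) g(2)]) (use f(2) g(3) in \<open>metis not_le\<close>)
    then have n: "ell2_sq w ?f' \<le> 2 - (1 / 2) ^ Suc k" using f(3) g(5) by simp
    have "g = (\<lambda>j. ?f' j + (- 1) * f j)" by auto
    then have "A g = (\<lambda>j. A ?f' j + (- 1) * A f j)" by (metis add scale)
    then have "(cmod (A g j))\<^sup>2 / w j \<le> 2 * ((cmod (A ?f' j))\<^sup>2 / w j) + 2 * ((cmod (A f j))\<^sup>2 / w j)" for j
      using norm_add_sq_le[of "A ?f' j" "(- 1) * A f j"] pos[of j] maps[OF g(2)] maps[OF f(1)]
        maps[OF ell2_add(1)[OF f(1) g(2)]]
      by (cases "j = 0") (auto simp: ell2_def field_simps)
    then have "?S M' (A g) \<le> (\<Sum>j\<le>M'. 2 * ((cmod (A ?f' j))\<^sup>2 / w j) + 2 * ((cmod (A f j))\<^sup>2 / w j))"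
      by (intro sum_mono)
    also have "\<dots> = 2 * ?S M' (A ?f') + 2 * ?S M' (A f)"
      by (simp add: sum.distrib sum_distrib_left)
    also have "?S M' (A f) \<le> ell2_sq w (A f)"
      by (rule ell2_partial_sum_le[OF maps[OF f(1)]]) simp
    finally have "real (Suc k) \<le> ?S M' (A ?f')" using g(6) by simp
    then have "?P (Suc k) (M', ?f')"
      using n ell2_add(1)[OF f(1) g(2)] f(2) g(1,4) by auto
    moreover have "?Q k x (M', ?f')" using g(1,3) by (simp add: x)
    ultimately show "\<exists>y. ?P (Suc k) y \<and> ?Q k x y"
      by (intro exI[of _ "(M', ?f')"] conjI)
  qed
  then obtain s where s: "\<forall>k. ?P k (s k) \<and> ?Q k (s k) (s (Suc k))" ..
  define M where "M k = fst (s k)" for k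
  define F where "F k = snd (s k)" for k
  have F: "F k \<in> ell2 w" "real k \<le> ?S (M k) (A (F k))" "ell2_sq w (F k) \<le> 2"
    and step: "M k < M (Suc k)" "\<And>j. j \<le> M k \<Longrightarrow> F (Suc k) j = F k j" for k
    using s[rule_format, of k] zero_le_power[of "1 / 2 :: real" k]
    by (auto simp: M_def F_def case_prod_unfold intro: order_trans)
  have Mk: "k \<le> M k" for k
    by (induction k) (use step(1) in \<open>auto intro: Suc_leI le_less_trans\<close>)
  have Mmono: "M k \<le> M l" if "k \<le> l" for k l
    using lift_Suc_mono_le[of M k l] step(1) that less_imp_le by blast
  have mono: "F l j = F k j" if "k \<le> l" "j \<le> M k" for k l j
    using that(1)
  proof (induction rule: dec_induct)
    case (step n)
    then show ?case using \<open>\<And>k j. j \<le> M k \<Longrightarrow> F (Suc k) j = F k j\<close> Mmono[of k n] that(2) by simp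
  qed simp
  define h where "h j = F j j" for j
  have h: "h j = F k j" if "j \<le> M k" for j k
    using mono[of j k j] mono[of k j j] Mk[of j] that by (cases "j \<le> k") (auto simp: h_def)
  have "(\<Sum>j<n. (cmod (h j))\<^sup>2 / w j) \<le> 2" for n
  proof -
    have "(\<Sum>j<n. (cmod (h j))\<^sup>2 / w j) = (\<Sum>j<n. (cmod (F n j))\<^sup>2 / w j)"
      using h[of _ n] Mk[of n] by (intro sum.cong refl) (simp add: order_trans less_imp_le)
    also have "\<dots> \<le> ell2_sq w (F n)" by (rule ell2_partial_sum_le[OF F(1)]) simp
    finally show ?thesis using F(3)[of n] by linarith
  qed
  then have hl: "h \<in> ell2 w"
    using F(1)[of 0] by (intro ell2I_bounded(1)[of h 2]) (auto simp: h_def ell2_def)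
  have "real k \<le> ell2_sq w (A h)" for k
  proof -
    have "?S (M k) (A h) = ?S (M k) (A (F k))"
      by (intro sum.cong refl arg_cong2[where f = "(/)"] arg_cong[where f = "\<lambda>z. (cmod z)\<^sup>2"] triangular)
        (use h in auto)
    then show ?thesis
      using F(2)[of k] ell2_partial_sum_le[OF maps[OF hl], of "{..M k}"] by simp
  qed
  then show False using reals_Archimedean2 not_le by blast
qed

end

section \<open>The Hilbert space and its multipliers as sequences\<close>

definition smooth :: "nat \<Rightarrow> nat set" where
  "smooth n = {j. 1 \<le> j \<and> (\<forall>p\<in>prime_factors j. p \<le> n)}"

locale dirichlet_weight = positive_weight w for w :: "nat \<Rightarrow> real" +
  assumes sigma_finite: "sigma_abscissa w < \<infinity>"
    and delta_finite: "\<bar>delta_abscissa w\<bar> \<noteq> \<infinity>"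
begin

definition \<delta> :: real where "\<delta> = real_of_ereal (delta_abscissa w)"

definition \<sigma> :: real where "\<sigma> = real_of_ereal (sigma_abscissa w)"

lemma delta_eq: "delta_abscissa w = ereal \<delta>"
  using delta_finite by (simp add: \<delta>_def ereal_real')

lemma delta_le_sigma_abscissa: "delta_abscissa w \<le> sigma_abscissa w"
  unfolding delta_abscissa_def sigma_abscissa_def
proof (rule Inf_superset_mono)
  have "(\<lambda>j. of_real (w j) * of_nat j powr (- s)) summable_on {j. 2 \<le> j \<and> gpf j \<le> nth_prime n}"
    if "(\<lambda>j. of_real (w j) * of_nat j powr (- s)) summable_on {j. 2 \<le> j}" for s :: complex and n
    by (rule summable_on_subset_banach[OF that]) auto
  then show "{ereal (Re s) | s. (\<lambda>j. of_real (w j) * of_nat j powr (- s)) summable_on {j. 2 \<le> j}}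
      \<subseteq> {ereal (Re s) | s. \<forall>n\<ge>1. (\<lambda>j. of_real (w j) * of_nat j powr (- s))
        summable_on {j. 2 \<le> j \<and> gpf j \<le> nth_prime n}}"
    by blast
qed

lemma sigma_eq: "sigma_abscissa w = ereal \<sigma>"
  using delta_le_sigma_abscissa sigma_finite unfolding delta_eq \<sigma>_def
  by (cases "sigma_abscissa w") auto

lemma delta_le_sigma: "\<delta> \<le> \<sigma>"
  using delta_le_sigma_abscissa by (simp add: delta_eq sigma_eq)

lemma H_domain_eq: "H_domain w = {s. \<sigma> / 2 < Re s}"
  by (simp add: H_domain_def half_plane_def sigma_eq)

lemma delta_half_plane: "half_plane (delta_abscissa w / 2) = {s. \<delta> / 2 < Re s}"
  by (simp add: half_plane_def delta_eq)

lemma H_domain_subset: "H_domain w \<subseteq> {s. \<delta> / 2 < Re s}"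
  using delta_le_sigma by (auto simp: H_domain_eq)

lemma summable_weight_on:
  assumes "(\<lambda>j. of_real (w j) * of_nat j powr (- s)) summable_on T"
    and "T \<subseteq> {2..}" "Re s \<le> x" "\<And>j. 2 \<le> j \<Longrightarrow> j \<in> S \<longleftrightarrow> j \<in> T"
  shows "summable (\<lambda>j. if j \<in> S then w j * real j powr (- x) else 0)"
proof -
  let ?f = "\<lambda>j. cmod (of_real (w j) * of_nat j powr (- s))"
  have "?f summable_on T"
    by (rule summable_on_iff_abs_summable_on_complex[THEN iffD1, OF assms(1)])
  then have "(\<lambda>j. if j \<in> T then ?f j else 0) summable_on UNIV"
    by (rule summable_on_cong_neutral[THEN iffD1, rotated -1]) auto
  then have s: "summable (\<lambda>j. if j \<in> T then ?f j else 0)"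
    by (subst (asm) summable_on_UNIV_nonneg_real_iff) auto
  show ?thesis
  \<comment> \<open>Finitely many terms do not affect summability, so \<open>S\<close> and \<open>T\<close> may differ below 2.\<close>
  proof (rule summable_comparison_test'[OF s, of 2])
    fix j :: nat assume "2 \<le> j"
    then have "j \<in> S \<longleftrightarrow> j \<in> T" by (rule assms(4))
    moreover have "\<bar>w j\<bar> * real j powr (- x) \<le> \<bar>w j\<bar> * real j powr (- Re s)"
      by (intro mult_left_mono nat_powr_antimono assms(3)) simp
    ultimately show "norm (if j \<in> S then w j * real j powr (- x) else 0) \<le> (if j \<in> T then ?f j else 0)"
      by (simp add: norm_mult norm_nat_powr abs_mult)
  qed
qed

text \<open>To the right of \<open>\<sigma>\<close> the whole kernel series converges; between \<open>\<delta>\<close> and \<open>\<sigma>\<close> only its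
  smooth parts do.\<close>

lemma summable_weight:
  assumes "\<sigma> < x"
  shows "summable (\<lambda>j. w j * real j powr (- x))"
proof -
  have "sigma_abscissa w < ereal x" using assms by (simp add: sigma_eq)
  then obtain s :: complex where "Re s < x" "(\<lambda>j. of_real (w j) * of_nat j powr (- s)) summable_on {j. 2 \<le> j}"
    unfolding sigma_abscissa_def Inf_less_iff by auto
  then have "summable (\<lambda>j. if j \<in> UNIV then w j * real j powr (- x) else 0)"
    by (intro summable_weight_on) auto
  then show ?thesis by simp
qed

lemma gpf_le_iff: "j \<ge> 2 \<Longrightarrow> gpf j \<le> n \<longleftrightarrow> (\<forall>p\<in>prime_factors j. p \<le> n)"
  unfolding gpf_def using prime_factorization_empty_iff[of j] by (subst Max_le_iff) auto

lemma summable_weight_smooth: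
  assumes "\<delta> < x"
  shows "summable (\<lambda>j. if j \<in> smooth n then w j * real j powr (- x) else 0)"
proof -
  have "delta_abscissa w < ereal x" using assms by (simp add: delta_eq)
  then obtain s :: complex where s: "Re s < x" "\<And>n. 1 \<le> n \<Longrightarrow>
      (\<lambda>j. of_real (w j) * of_nat j powr (- s)) summable_on {j. 2 \<le> j \<and> gpf j \<le> nth_prime n}"
    unfolding delta_abscissa_def Inf_less_iff by auto
  have "n \<le> nth_prime (Suc n)"
    using le_enumerate[OF primes_infinite] by (simp add: nth_prime_def)
  have sub: "{j. 2 \<le> j \<and> (\<forall>p\<in>prime_factors j. p \<le> n)} \<subseteq> {j. 2 \<le> j \<and> gpf j \<le> nth_prime (Suc n)}"
  proof safe
    fix j assume "2 \<le> j" "\<forall>p\<in>prime_factors j. p \<le> n"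
    then have "gpf j \<le> n" by (simp add: gpf_le_iff)
    then show "gpf j \<le> nth_prime (Suc n)" using \<open>n \<le> nth_prime (Suc n)\<close> by simp
  qed
  have "(\<lambda>j. of_real (w j) * of_nat j powr (- s)) summable_on {j. 2 \<le> j \<and> (\<forall>p\<in>prime_factors j. p \<le> n)}"
    by (rule summable_on_subset_banach[OF s(2) sub]) simp
  then show ?thesis
    by (rule summable_weight_on) (use s(1) in \<open>auto simp: smooth_def\<close>)
qed

text \<open>The Cauchy-Schwarz inequality, in the additive form that becomes the usual one for the
  best value of \<open>t\<close>.\<close>

lemma ell2_cauchy_schwarz:
  assumes c: "c \<in> ell2 w" and t: "t > 0"
    and ker: "summable (\<lambda>j. if j \<in> T then w j * real j powr (- (2 * x)) else 0)"
  shows "summable (\<lambda>j. if j \<in> T then cmod (c j) * real j powr (- x) else 0)"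
    and "2 * (\<Sum>j. if j \<in> T then cmod (c j) * real j powr (- x) else 0)
      \<le> t * ell2_sq w c + (\<Sum>j. if j \<in> T then w j * real j powr (- (2 * x)) else 0) / t"
proof -
  let ?l = "\<lambda>j. if j \<in> T then cmod (c j) * real j powr (- x) else 0"
  let ?k = "\<lambda>j. if j \<in> T then w j * real j powr (- (2 * x)) else 0"
  let ?u = "\<lambda>j. t * ((cmod (c j))\<^sup>2 / w j) + ?k j / t"
  have le: "2 * ?l j \<le> ?u j" for j
  proof (cases "j = 0")
    case False
    then have W: "w j > 0" using pos by simp
    let ?a = "cmod (c j)" and ?v = "real j powr (- x)"
    have v: "real j powr (- (2 * x)) = ?v\<^sup>2"
      using False by (simp add: powr_power mult.commute)
    have "0 \<le> (t * ?a - w j * ?v)\<^sup>2 / (t * w j)" using t W by simp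
    also have "\<dots> = t * (?a\<^sup>2 / w j) + w j * ?v\<^sup>2 / t - 2 * (?a * ?v)"
      using t W by (simp add: field_simps power2_eq_square)
    finally show ?thesis
      using t W ell2_term_nonneg[OF c, of j] by (simp add: v)
  qed (use c in \<open>simp add: ell2_def\<close>)
  have s: "summable ?u"
    by (intro summable_add summable_mult summable_divide ell2_summable c ker)
  then have "summable (\<lambda>j. ?u j / 2)" by (rule summable_divide)
  then show sl: "summable ?l"
  proof (rule summable_comparison_test'[of _ 0])
    show "norm (?l j) \<le> ?u j / 2" for j using le[of j] by auto
  qed
  have "2 * (\<Sum>j. ?l j) = (\<Sum>j. 2 * ?l j)" by (rule suminf_mult[OF sl, symmetric])
  also have "\<dots> \<le> (\<Sum>j. ?u j)" by (rule suminf_le[OF le summable_mult[OF sl] s])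
  also have "\<dots> = t * ell2_sq w c + (\<Sum>j. ?k j) / t"
    unfolding ell2_sq_def
    by (simp only: suminf_add[symmetric] suminf_mult suminf_divide summable_mult summable_divide
        ell2_summable[OF c] ker)
  finally show "2 * (\<Sum>j. ?l j) \<le> t * ell2_sq w c + (\<Sum>j. ?k j) / t" .
qed

lemma ell2_converges_absolutely:
  assumes "c \<in> ell2 w" "\<sigma> / 2 < x"
  shows "converges_absolutely c x"
  using ell2_cauchy_schwarz(1)[OF assms(1) zero_less_one, of UNIV x] summable_weight[of "2 * x"] assms(2)
  by (simp add: converges_absolutely_def)

definition ell2_fun :: "(nat \<Rightarrow> complex) \<Rightarrow> complex \<Rightarrow> complex" where
  "ell2_fun c s = (if s \<in> H_domain w then dirichlet_value c s else 0)"

lemma ell2_fun_sums: "c \<in> ell2 w \<Longrightarrow> s \<in> H_domain w \<Longrightarrow> dirichlet_sums c s (ell2_fun c s)"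
  using ell2_converges_absolutely dirichlet_sums_value[of c "Re s" s]
  by (simp add: ell2_fun_def H_domain_eq)

lemma has_dirichlet_series_ell2_fun: "c \<in> ell2 w \<Longrightarrow> has_dirichlet_series (ell2_fun c) c"
  unfolding has_dirichlet_series_def using ell2_fun_sums
  by (intro exI[of _ "\<sigma> / 2"]) (auto simp: H_domain_eq half_plane_def)

lemma H_space_eq: "H_space w = ell2_fun ` ell2 w"
proof (intro equalityI subsetI)
  fix f assume "f \<in> H_space w"
  then obtain a where a: "summable (\<lambda>j. (cmod (a (Suc j)))\<^sup>2 / w (Suc j))"
      "\<And>s. s \<in> H_domain w \<Longrightarrow> dirichlet_sums a s (f s)" "\<And>s. s \<notin> H_domain w \<Longrightarrow> f s = 0"
    by (auto simp: H_space_def functions_on_def)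
  define c where "c = a(0 := 0)"
  have "summable (\<lambda>j. (cmod (c j))\<^sup>2 / w j)"
    using a(1) by (subst summable_Suc_iff[symmetric]) (simp add: c_def)
  then have "c \<in> ell2 w" by (simp add: ell2_def c_def)
  moreover have "f = ell2_fun c"
  proof
    fix s
    have "dirichlet_sums c s (f s)" if "s \<in> H_domain w"
      using a(2)[OF that] by (simp add: dirichlet_sums_def c_def)
    then show "f s = ell2_fun c s"
      using a(3)[of s] dirichlet_value_unique[of c s "f s"] by (auto simp: ell2_fun_def)
  qed
  ultimately show "f \<in> ell2_fun ` ell2 w" by blast
next
  fix f assume "f \<in> ell2_fun ` ell2 w"
  then obtain c where c: "c \<in> ell2 w" "f = ell2_fun c" by blast
  have "summable (\<lambda>j. (cmod (c (Suc j)))\<^sup>2 / w (Suc j))"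
    by (rule summable_Suc_iff[THEN iffD2, OF ell2_summable[OF c(1)]])
  then show "f \<in> H_space w"
    using ell2_fun_sums c by (auto simp: H_space_def functions_on_def ell2_fun_def)
qed

lemma ell2_fun_in_H_space: "c \<in> ell2 w \<Longrightarrow> ell2_fun c \<in> H_space w"
  by (simp add: H_space_eq)

lemma dirichlet_coeff_ell2_fun:
  assumes "c \<in> ell2 w"
  shows "dirichlet_coeff (ell2_fun c) = c"
  unfolding dirichlet_coeff_def
proof (rule the_equality)
  show "c 0 = 0 \<and> has_dirichlet_series (ell2_fun c) c"
    using assms has_dirichlet_series_ell2_fun by (simp add: ell2_def)
  fix a assume a: "a 0 = 0 \<and> has_dirichlet_series (ell2_fun c) a"
  show "a = c"
  proof
    fix j show "a j = c j"
      using a assms dirichlet_coefficients_unique[OF _ has_dirichlet_series_ell2_fun[OF assms]]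
      by (cases "j = 0") (auto simp: ell2_def)
  qed
qed

lemma H_norm_ell2_fun:
  assumes "c \<in> ell2 w"
  shows "H_norm w (ell2_fun c) = sqrt (ell2_sq w c)"
proof -
  have "(\<Sum>j. (cmod (c (Suc j)))\<^sup>2 / w (Suc j)) = ell2_sq w c"
    unfolding ell2_sq_def using suminf_split_head[OF ell2_summable[OF assms]] assms
    by (simp add: ell2_def)
  then show ?thesis by (simp add: H_norm_def dirichlet_coeff_ell2_fun[OF assms])
qed

lemma ell2_fun_mult:
  assumes "a \<in> ell2 w" "c \<in> ell2 w"
  shows "ell2_fun a s * ell2_fun c s = ell2_fun (dirichlet_conv a c) s"
  using dirichlet_conv_value[of a "Re s" c s] ell2_converges_absolutely[OF assms(1)]
    ell2_converges_absolutely[OF assms(2)]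
  by (auto simp: ell2_fun_def H_domain_eq)

definition multiplier_sequences :: "(nat \<Rightarrow> complex) set" where
  "multiplier_sequences = {a \<in> ell2 w. \<forall>c\<in>ell2 w. dirichlet_conv a c \<in> ell2 w}"

text \<open>Multiplying functions is convolving coefficients, by the uniqueness of Dirichlet coefficients.\<close>

lemma multipliers_eq: "multipliers w = ell2_fun ` multiplier_sequences"
proof (intro equalityI subsetI)
  fix \<phi> assume "\<phi> \<in> multipliers w"
  then have \<phi>: "\<And>s. s \<notin> H_domain w \<Longrightarrow> \<phi> s = 0"
      "\<And>f. f \<in> H_space w \<Longrightarrow> (\<lambda>s. \<phi> s * f s) \<in> H_space w"
    by (auto simp: multipliers_def functions_on_def)
  \<comment> \<open>The constant function 1 lies in the space, hence so does every multiplier.\<close>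
  define e :: "nat \<Rightarrow> complex" where "e j = (if j \<in> {1} then 1 else 0)" for j
  have e: "e \<in> ell2 w" by (rule ell2_finite_support(1)[of _ 1]) (auto simp: e_def)
  have "dirichlet_value e s = 1" for s
    unfolding e_def using dirichlet_polynomial(2)[of "{1}" "\<lambda>_. 1" s] by simp
  then have "(\<lambda>s. \<phi> s * ell2_fun e s) = \<phi>" using \<phi>(1) by (auto simp: ell2_fun_def)
  then have "\<phi> \<in> H_space w" using \<phi>(2)[OF ell2_fun_in_H_space[OF e]] by simp
  then obtain a where a: "a \<in> ell2 w" "\<phi> = ell2_fun a" by (auto simp: H_space_eq)
  have "dirichlet_conv a c \<in> ell2 w" if c: "c \<in> ell2 w" for c
  proof -
    have "ell2_fun (dirichlet_conv a c) \<in> H_space w"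
      using \<phi>(2)[OF ell2_fun_in_H_space[OF c]] by (simp add: a(2) ell2_fun_mult[OF a(1) c])
    then obtain b where b: "b \<in> ell2 w" "ell2_fun (dirichlet_conv a c) = ell2_fun b"
      by (auto simp: H_space_eq)
    have "dirichlet_sums (dirichlet_conv a c) s (ell2_fun b s)" if "s \<in> H_domain w" for s
      using that b(2) dirichlet_sums_value[of _ "Re s" s]
        dirichlet_conv_converges[OF ell2_converges_absolutely[OF a(1)] ell2_converges_absolutely[OF c]]
      by (metis (mono_tags, lifting) H_domain_eq ell2_fun_def mem_Collect_eq order_refl)
    then have "has_dirichlet_series (ell2_fun b) (dirichlet_conv a c)"
      unfolding has_dirichlet_series_def
      by (intro exI[of _ "\<sigma> / 2"]) (auto simp: H_domain_eq half_plane_def)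
    then have "dirichlet_conv a c j = b j" if "j \<ge> 1" for j
      using dirichlet_coefficients_unique has_dirichlet_series_ell2_fun[OF b(1)] that by blast
    moreover have "dirichlet_conv a c 0 = b 0" using b(1) by (simp add: ell2_def)
    ultimately have "dirichlet_conv a c = b"
      by (metis ext less_one not_le)
    then show ?thesis using b(1) by simp
  qed
  then show "\<phi> \<in> ell2_fun ` multiplier_sequences"
    using a by (auto simp: multiplier_sequences_def)
next
  fix \<phi> assume "\<phi> \<in> ell2_fun ` multiplier_sequences"
  then obtain a where a: "a \<in> ell2 w" "\<And>c. c \<in> ell2 w \<Longrightarrow> dirichlet_conv a c \<in> ell2 w" "\<phi> = ell2_fun a"
    by (auto simp: multiplier_sequences_def)
  have "(\<lambda>s. \<phi> s * f s) \<in> H_space w" if "f \<in> H_space w" for f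
    using that a by (auto simp: H_space_eq ell2_fun_mult)
  then show "\<phi> \<in> multipliers w"
    using a(3) by (simp add: multipliers_def functions_on_def ell2_fun_def)
qed

lemma multiplier_sequence_bounded:
  assumes "a \<in> multiplier_sequences"
  obtains C where "\<And>c. c \<in> ell2 w \<Longrightarrow> ell2_sq w (dirichlet_conv a c) \<le> C * ell2_sq w c"
proof (rule triangular_operator_bounded[of "dirichlet_conv a"])
  show "dirichlet_conv a (\<lambda>j. f j + g j) = (\<lambda>j. dirichlet_conv a f j + dirichlet_conv a g j)" for f g
    by (rule ext) (simp add: dirichlet_conv_def ring_distribs sum.distrib)
  show "dirichlet_conv a (\<lambda>j. z * f j) = (\<lambda>j. z * dirichlet_conv a f j)" for z f
    by (rule ext) (simp add: dirichlet_conv_def sum_distrib_left mult.left_commute)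
  show "dirichlet_conv a f j = dirichlet_conv a g j" if "\<And>i. i \<le> j \<Longrightarrow> f i = g i" for f g j
    using that by (simp add: dirichlet_conv_def)
qed (use assms that in \<open>auto simp: multiplier_sequences_def\<close>)

lemma multiplier_norm_ell2_fun:
  assumes a: "a \<in> multiplier_sequences"
  shows "multiplier_norm w (ell2_fun a)
    = (SUP c\<in>{c \<in> ell2 w. ell2_sq w c \<le> 1}. sqrt (ell2_sq w (dirichlet_conv a c)))"
proof -
  have "{f \<in> H_space w. H_norm w f \<le> 1} = ell2_fun ` {c \<in> ell2 w. ell2_sq w c \<le> 1}"
    by (auto simp: H_space_eq H_norm_ell2_fun)
  moreover have "H_norm w (\<lambda>s. ell2_fun a s * ell2_fun c s) = sqrt (ell2_sq w (dirichlet_conv a c))"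
    if "c \<in> ell2 w" for c
    using a that by (simp add: multiplier_sequences_def ell2_fun_mult H_norm_ell2_fun)
  ultimately show ?thesis
    unfolding multiplier_norm_def by (auto simp: image_image intro!: SUP_cong)
qed

lemma multiplier_norm_bound:
  assumes a: "a \<in> multiplier_sequences"
  shows "0 \<le> multiplier_norm w (ell2_fun a)"
    and "c \<in> ell2 w \<Longrightarrow> ell2_sq w (dirichlet_conv a c) \<le> (multiplier_norm w (ell2_fun a))\<^sup>2 * ell2_sq w c"
proof -
  let ?m = "multiplier_norm w (ell2_fun a)"
  let ?U = "{c \<in> ell2 w. ell2_sq w c \<le> 1}"
  obtain C where C: "\<And>c. c \<in> ell2 w \<Longrightarrow> ell2_sq w (dirichlet_conv a c) \<le> C * ell2_sq w c"
    using multiplier_sequence_bounded[OF a] by blast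
  have conv: "dirichlet_conv a c \<in> ell2 w" if "c \<in> ell2 w" for c
    using a that by (simp add: multiplier_sequences_def)
  have bdd: "bdd_above ((\<lambda>c. sqrt (ell2_sq w (dirichlet_conv a c))) ` ?U)"
  proof (rule bdd_aboveI2[of _ _ "sqrt \<bar>C\<bar>"])
    fix c assume c: "c \<in> ?U"
    have "C * ell2_sq w c \<le> \<bar>C\<bar> * 1"
      using c ell2_sq_nonneg by (intro mult_mono) auto
    then show "sqrt (ell2_sq w (dirichlet_conv a c)) \<le> sqrt \<bar>C\<bar>"
      using C[of c] c by simp
  qed
  have le: "sqrt (ell2_sq w (dirichlet_conv a c)) \<le> ?m" if "c \<in> ?U" for c
    unfolding multiplier_norm_ell2_fun[OF a] by (rule cSUP_upper[OF that bdd])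
  have "(\<lambda>j. 0) \<in> ?U" by (simp add: ell2_def ell2_sq_def)
  from le[OF this] show "0 \<le> ?m"
    using ell2_sq_nonneg conv \<open>(\<lambda>j. 0) \<in> ?U\<close> by (metis (lifting) mem_Collect_eq order_trans real_sqrt_ge_zero)
  show "ell2_sq w (dirichlet_conv a c) \<le> ?m\<^sup>2 * ell2_sq w c" if c: "c \<in> ell2 w"
  proof (cases "ell2_sq w c = 0")
    case True
    then show ?thesis using C[OF c] by simp
  next
    case False
    then have p: "ell2_sq w c > 0" using ell2_sq_nonneg[OF c] by simp
    define z where "z = complex_of_real (1 / sqrt (ell2_sq w c))"
    have z: "(cmod z)\<^sup>2 = 1 / ell2_sq w c"
      using p by (simp add: z_def norm_divide power_divide)
    have "(\<lambda>j. z * c j) \<in> ?U"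
      using ell2_scale[OF c, of z] p by (simp add: z)
    from le[OF this] have "sqrt (ell2_sq w (dirichlet_conv a (\<lambda>j. z * c j))) \<le> ?m" .
    moreover have "dirichlet_conv a (\<lambda>j. z * c j) = (\<lambda>j. z * dirichlet_conv a c j)"
      by (rule ext) (simp add: dirichlet_conv_def sum_distrib_left mult.left_commute)
    ultimately have "sqrt (ell2_sq w (dirichlet_conv a c) / ell2_sq w c) \<le> ?m"
      using ell2_scale(2)[OF conv[OF c], of z] by (simp add: z)
    then have "ell2_sq w (dirichlet_conv a c) / ell2_sq w c \<le> ?m\<^sup>2"
      by (rule sqrt_le_D)
    then show ?thesis using p by (simp add: field_simps)
  qed
qed

lemma multiplier_norm_least:
  assumes a: "a \<in> multiplier_sequences" and "0 \<le> K"
    and K: "\<And>c. c \<in> ell2 w \<Longrightarrow> ell2_sq w (dirichlet_conv a c) \<le> K\<^sup>2 * ell2_sq w c"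
  shows "multiplier_norm w (ell2_fun a) \<le> K"
  unfolding multiplier_norm_ell2_fun[OF a]
proof (rule cSUP_least)
  show "{c \<in> ell2 w. ell2_sq w c \<le> 1} \<noteq> {}"
    by (auto simp: ell2_def ell2_sq_def intro!: exI[of _ "\<lambda>j. 0"])
  fix c assume c: "c \<in> {c \<in> ell2 w. ell2_sq w c \<le> 1}"
  then have "ell2_sq w (dirichlet_conv a c) \<le> K\<^sup>2 * ell2_sq w c" using K by simp
  also have "\<dots> \<le> K\<^sup>2" using c by (simp add: mult_left_le)
  finally show "sqrt (ell2_sq w (dirichlet_conv a c)) \<le> K"
    using assms(2) by (simp add: real_le_lsqrt)
qed

end

section \<open>Smooth parts and the extension of multipliers\<close>

lemma smooth_dvd: "j \<in> smooth n \<Longrightarrow> d dvd j \<Longrightarrow> d \<in> smooth n"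
  using dvd_prime_factors[of j d] by (fastforce simp: smooth_def Suc_le_eq intro: dvd_pos_nat)

lemma smooth_mult: "d \<in> smooth n \<Longrightarrow> k \<in> smooth n \<Longrightarrow> d * k \<in> smooth n"
  by (auto simp: smooth_def prime_factors_product)

lemma le_in_smooth: "1 \<le> j \<Longrightarrow> j \<le> n \<Longrightarrow> j \<in> smooth n"
  by (auto simp: smooth_def dest!: in_prime_factors_imp_dvd dvd_imp_le)

definition smooth_part :: "nat \<Rightarrow> (nat \<Rightarrow> complex) \<Rightarrow> nat \<Rightarrow> complex" where
  "smooth_part n c j = (if j \<in> smooth n then c j else 0)"

text \<open>The smooth numbers contain the divisors and the products of their members, so taking the
  smooth part is multiplicative for the convolution.\<close>

lemma smooth_part_conv:
  "dirichlet_conv (smooth_part n a) (smooth_part n c) = smooth_part n (dirichlet_conv a c)"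
proof
  fix j
  show "dirichlet_conv (smooth_part n a) (smooth_part n c) j = smooth_part n (dirichlet_conv a c) j"
  proof (cases "j \<in> smooth n")
    case True
    then have "d \<in> smooth n \<and> j div d \<in> smooth n" if "d dvd j" for d
      using smooth_dvd[of j n] that by (metis dvd_div_mult_self dvd_triv_left)
    then show ?thesis
      using True by (auto simp: dirichlet_conv_def smooth_part_def intro!: sum.cong)
  next
    case False
    then have "d \<notin> smooth n \<or> j div d \<notin> smooth n" if "d dvd j" for d
      using smooth_mult[of d n "j div d"] that by auto
    then show ?thesis
      using False by (auto simp: dirichlet_conv_def smooth_part_def intro!: sum.neutral)
  qed
qed

context dirichlet_weight
begin

lemma smooth_part_converges:
  assumes "c \<in> ell2 w" "\<delta> / 2 < x"
  shows "converges_absolutely (smooth_part n c) x"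
proof -
  have "summable (\<lambda>j. if j \<in> smooth n then cmod (c j) * real j powr (- x) else 0)"
    using ell2_cauchy_schwarz(1)[OF assms(1) zero_less_one] summable_weight_smooth[of "2 * x" n] assms(2)
    by simp
  moreover have "(\<lambda>j. if j \<in> smooth n then cmod (c j) * real j powr (- x) else 0)
      = (\<lambda>j. cmod (smooth_part n c j) * real j powr (- x))"
    by (auto simp: smooth_part_def)
  ultimately show ?thesis by (simp add: converges_absolutely_def)
qed

text \<open>Point evaluation at \<open>s\<close> is a continuous functional on the functions with smooth frequencies,
  represented by the kernel \<open>k\<close>. The value of the smooth part of a multiplier at \<open>s\<close> is, up to
  conjugation, an eigenvalue of the adjoint of the compressed multiplication operator, with eigenvector
  \<open>k\<close>;
  evaluating \<open>a * k\<close> at \<open>s\<close> makes this explicit.\<close>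

lemma smooth_part_bound:
  assumes a: "a \<in> multiplier_sequences" and s: "\<delta> / 2 < Re s"
  shows "cmod (dirichlet_value (smooth_part n a) s) \<le> multiplier_norm w (ell2_fun a)"
proof (rule dense_ge)
  \<comment> \<open>Work with a strict bound \<open>m\<close>, as its reciprocal is needed as the parameter \<open>t\<close> below.\<close>
  fix m assume m: "multiplier_norm w (ell2_fun a) < m"
  then have "m > 0" using multiplier_norm_bound(1)[OF a] by simp
  let ?x = "Re s"
  let ?ker = "\<lambda>j. if j \<in> smooth n then w j * real j powr (- (2 * ?x)) else 0"
  define \<kappa> where "\<kappa> = (\<Sum>j. ?ker j)"
  define k where "k = smooth_part n (\<lambda>j. of_real (w j) * cnj (of_nat j powr (- s)))"
  have wpos: "w j > 0" if "j \<in> smooth n" for j using that pos by (simp add: smooth_def)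
  have ker: "summable ?ker" using summable_weight_smooth[of "2 * ?x" n] s by simp
  have sq: "real j powr (- (2 * ?x)) = (real j powr (- ?x))\<^sup>2" for j
    by (cases "j = 0") (simp_all add: powr_power mult.commute)
  have "(cmod (k j))\<^sup>2 / w j = ?ker j" for j
    using wpos[of j]
    by (auto simp: k_def smooth_part_def norm_mult norm_nat_powr sq power2_eq_square)
  then have k: "k \<in> ell2 w" and k_sq: "ell2_sq w k = \<kappa>"
    using ker by (auto simp: ell2_def ell2_sq_def \<kappa>_def k_def smooth_part_def smooth_def)
  have "1 \<in> smooth n" by (simp add: smooth_def)
  have "0 < \<kappa>"
    unfolding \<kappa>_def
  proof (rule suminf_pos2[OF ker, of 1])
    show "0 \<le> ?ker j" for j
      using less_imp_le[OF wpos[of j]] by simp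
    show "0 < ?ker 1" using wpos[of 1] \<open>1 \<in> smooth n\<close> by simp
  qed
  have "k j * of_nat j powr (- s) = of_real (?ker j)" for j
  proof -
    have "cnj (of_nat j powr (- s)) * of_nat j powr (- s) = of_real ((real j powr (- ?x))\<^sup>2)"
      by (metis complex_norm_square mult.commute norm_nat_powr of_real_power)
    then show ?thesis by (simp add: k_def smooth_part_def sq mult.assoc)
  qed
  then have val_k: "dirichlet_value k s = of_real \<kappa>"
    unfolding dirichlet_value_def \<kappa>_def using suminf_of_real[OF ker, where 'a = complex] by simp
  let ?b = "dirichlet_conv a k"
  have b: "?b \<in> ell2 w" using a k by (simp add: multiplier_sequences_def)
  have k_smooth: "smooth_part n k = k" by (auto simp: k_def smooth_part_def)
  have ca: "converges_absolutely (smooth_part n a) ?x"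
    using a s smooth_part_converges by (simp add: multiplier_sequences_def)
  have ck: "converges_absolutely k ?x"
    using smooth_part_converges[OF k s, of n] by (simp add: k_smooth)
  have cb: "converges_absolutely (smooth_part n ?b) ?x" by (rule smooth_part_converges[OF b s])
  have "dirichlet_value (smooth_part n ?b) s = dirichlet_value (smooth_part n a) s * of_real \<kappa>"
    using dirichlet_conv_value[OF ca ck order_refl] smooth_part_conv[of n a k]
    by (simp add: k_smooth val_k)
  then have "cmod (dirichlet_value (smooth_part n a) s) * \<kappa> = cmod (dirichlet_value (smooth_part n ?b) s)"
    using \<open>0 < \<kappa>\<close> by (simp add: norm_mult)
  also have "\<dots> \<le> (\<Sum>j. norm (smooth_part n ?b j * of_nat j powr (- s)))"
    unfolding dirichlet_value_def by (rule summable_norm[OF dirichlet_summable_norm[OF cb order_refl]])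
  also have "\<dots> = (\<Sum>j. if j \<in> smooth n then cmod (?b j) * real j powr (- ?x) else 0)"
    by (intro suminf_cong) (simp add: smooth_part_def norm_mult norm_nat_powr)
  also have "\<dots> \<le> ((1 / m) * ell2_sq w ?b + \<kappa> / (1 / m)) / 2"
    using ell2_cauchy_schwarz(2)[OF b _ ker, of "1 / m"] \<open>m > 0\<close> by (simp add: \<kappa>_def)
  also have "\<dots> \<le> ((1 / m) * (m\<^sup>2 * \<kappa>) + \<kappa> / (1 / m)) / 2"
  proof -
    have "ell2_sq w ?b \<le> (multiplier_norm w (ell2_fun a))\<^sup>2 * \<kappa>"
      using multiplier_norm_bound(2)[OF a k] by (simp add: k_sq)
    also have "\<dots> \<le> m\<^sup>2 * \<kappa>"
      using m multiplier_norm_bound(1)[OF a] \<open>0 < \<kappa>\<close> by (intro mult_right_mono power_mono) auto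
    finally show ?thesis
      using \<open>m > 0\<close> by (intro divide_right_mono add_right_mono mult_left_mono) auto
  qed
  also have "\<dots> = m * \<kappa>" using \<open>m > 0\<close> by (simp add: power2_eq_square)
  finally show "cmod (dirichlet_value (smooth_part n a) s) \<le> m" using \<open>0 < \<kappa>\<close> by simp
qed

lemma smooth_part_holomorphic:
  assumes "c \<in> ell2 w"
  shows "dirichlet_value (smooth_part n c) holomorphic_on {s. \<delta> / 2 < Re s}"
proof -
  have "dirichlet_value (smooth_part n c) field_differentiable at s" if s: "\<delta> / 2 < Re s" for s
  proof -
    obtain x where x: "\<delta> / 2 < x" "x < Re s" using dense[OF s] by blast
    show ?thesis
      using holomorphic_on_imp_differentiable_at[OF
          dirichlet_value_holomorphic[OF smooth_part_converges[OF assms x(1), of n]]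
          open_halfspace_Re_gt[of x]] x(2) by simp
  qed
  then show ?thesis
    by (simp add: holomorphic_on_def field_differentiable_at_within)
qed

lemma ell2_fun_holomorphic:
  assumes "c \<in> ell2 w"
  shows "ell2_fun c holomorphic_on H_domain w"
proof -
  have "dirichlet_value c field_differentiable at s" if s: "\<sigma> / 2 < Re s" for s
  proof -
    obtain x where x: "\<sigma> / 2 < x" "x < Re s" using dense[OF s] by blast
    show ?thesis
      using holomorphic_on_imp_differentiable_at[OF
          dirichlet_value_holomorphic[OF ell2_converges_absolutely[OF assms x(1)]]
          open_halfspace_Re_gt[of x]] x(2) by simp
  qed
  then have "dirichlet_value c holomorphic_on H_domain w"
    by (simp add: holomorphic_on_def field_differentiable_at_within H_domain_eq)
  then show ?thesis
    by (rule holomorphic_transform) (simp add: ell2_fun_def)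
qed

lemma smooth_part_tendsto:
  assumes "c \<in> ell2 w" "s \<in> H_domain w"
  shows "(\<lambda>n. dirichlet_value (smooth_part n c) s) \<longlonglongrightarrow> ell2_fun c s"
proof -
  let ?f = "\<lambda>j n. smooth_part n c j * of_nat j powr (- s)"
  let ?M = "\<lambda>j. cmod (c j * of_nat j powr (- s))"
  have "summable ?M"
    using dirichlet_summable_norm[OF ell2_converges_absolutely[OF assms(1)] order_refl] assms(2)
    by (simp add: H_domain_eq)
  moreover have "(?f j \<longlongrightarrow> c j * of_nat j powr (- s)) sequentially" for j
  proof (rule tendsto_eventually)
    show "\<forall>\<^sub>F n in sequentially. ?f j n = c j * of_nat j powr (- s)"
      using eventually_ge_at_top[of j]
      by eventually_elim (use le_in_smooth[of j] in \<open>cases "j = 0"; auto simp: smooth_part_def\<close>)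
  qed
  moreover have "\<forall>\<^sub>F (j, n) in sequentially \<times>\<^sub>F sequentially. norm (?f j n) \<le> ?M j"
    by (intro always_eventually) (auto simp: smooth_part_def)
  ultimately have "(\<lambda>n. \<Sum>j. ?f j n) \<longlonglongrightarrow> (\<Sum>j. c j * of_nat j powr (- s))"
    using tannerys_theorem[of ?f "\<lambda>j. c j * of_nat j powr (- s)" sequentially ?M] by simp
  then show ?thesis
    using assms(2) by (simp add: dirichlet_value_def ell2_fun_def)
qed

text \<open>The smooth parts are uniformly bounded on the large half-plane and converge to the multiplier
  on the small one; a normal family argument extends the limit.\<close>

lemma multiplier_extends:
  assumes a: "a \<in> multiplier_sequences"
  obtains g where "g holomorphic_on {s. \<delta> / 2 < Re s}"
    and "\<And>s. \<delta> / 2 < Re s \<Longrightarrow> cmod (g s) \<le> multiplier_norm w (ell2_fun a)"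
    and "\<And>s. s \<in> H_domain w \<Longrightarrow> g s = ell2_fun a s"
proof -
  let ?S = "{s. \<delta> / 2 < Re s}" and ?m = "multiplier_norm w (ell2_fun a)"
  let ?F = "\<lambda>n. dirichlet_value (smooth_part n a)"
  let ?H = "{h. h holomorphic_on ?S \<and> (\<forall>s\<in>?S. cmod (h s) \<le> ?m)}"
  have al: "a \<in> ell2 w" using a by (simp add: multiplier_sequences_def)
  have op: "open ?S" by (rule open_halfspace_Re_gt)
  have rng: "range ?F \<subseteq> ?H"
    using smooth_part_holomorphic[OF al] smooth_part_bound[OF a] by auto
  obtain g r where g: "g holomorphic_on ?S" and r: "strict_mono (r :: nat \<Rightarrow> nat)"
    and lim: "\<And>s. s \<in> ?S \<Longrightarrow> (\<lambda>n. ?F (r n) s) \<longlonglongrightarrow> g s"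
    by (rule Montel[OF op _ _ rng]) (blast, blast, rule that)
  have "cmod (g s) \<le> ?m" if "\<delta> / 2 < Re s" for s
    by (rule Lim_bounded[OF tendsto_norm[OF lim], of s 0])
      (use that smooth_part_bound[OF a] in auto)
  moreover have "g s = ell2_fun a s" if "s \<in> H_domain w" for s
  proof (rule LIMSEQ_unique)
    show "(\<lambda>n. ?F (r n) s) \<longlonglongrightarrow> g s" using lim that H_domain_subset by blast
    show "(\<lambda>n. ?F (r n) s) \<longlonglongrightarrow> ell2_fun a s"
      using LIMSEQ_subseq_LIMSEQ[OF smooth_part_tendsto[OF al that] r] by (simp add: o_def)
  qed
  ultimately show ?thesis using that g by blast
qed

text \<open>Extensions to the large half-plane are unique, which makes extending an algebra homomorphism.\<close>

lemma holomorphic_eq_on_half_plane: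
  assumes "f holomorphic_on {s. \<delta> / 2 < Re s}" "g holomorphic_on {s. \<delta> / 2 < Re s}"
    and "\<And>s. s \<in> H_domain w \<Longrightarrow> f s = g s" "\<delta> / 2 < Re s"
  shows "f s = g s"
proof (rule analytic_continuation_open[OF _ _ _ _ H_domain_subset assms(1,2,3)])
  show "open (H_domain w)" unfolding H_domain_eq by (rule open_halfspace_Re_gt)
  show "open {s. \<delta> / 2 < Re s}" by (rule open_halfspace_Re_gt)
  show "connected {s. \<delta> / 2 < Re s}"
    by (intro convex_connected convex_halfspace_Re_gt)
  have "of_real (\<sigma> / 2 + 1) \<in> H_domain w" by (simp add: H_domain_eq)
  then show "H_domain w \<noteq> {}" by blast
qed (use assms(4) in auto)

end

section \<open>Bounded functions as multipliers\<close>

locale multiplicative_weight = dirichlet_weight +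
  assumes multiplicative: "m \<ge> 1 \<Longrightarrow> n \<ge> 1 \<Longrightarrow> coprime m n \<Longrightarrow> w (m * n) = w m * w n"
    and growth: "j \<ge> 1 \<Longrightarrow> prime p \<Longrightarrow>
      w (p ^ (j - 1)) / w (p ^ j) \<le> real p powr (- real_of_ereal (delta_abscissa w))"
begin

text \<open>The weight \<open>j powr \<delta> / w j\<close> is multiplicative and, by the growth condition, nonincreasing along
  the powers of each prime, so Abel summation turns
  Bessel's inequality, with its weight \<open>j powr (- \<delta>)\<close>, into an inequality for the weight \<open>1 / w j\<close>.\<close>

lemma bounded_function_conv:
  assumes hol: "\<phi> holomorphic_on {s. \<delta> / 2 < Re s}" and bd: "\<And>s. \<delta> / 2 < Re s \<Longrightarrow> cmod (\<phi> s) \<le> K"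
    and ser: "has_dirichlet_series \<phi> a" and c: "c \<in> ell2 w"
  shows "dirichlet_conv a c \<in> ell2 w" "ell2_sq w (dirichlet_conv a c) \<le> K\<^sup>2 * ell2_sq w c"
proof -
  let ?b = "dirichlet_conv a c"
  define r where "r j = real j powr \<delta> / w j" for j
  define X where "X j = (K\<^sup>2 * (cmod (c j))\<^sup>2 - (cmod (?b j))\<^sup>2) * real j powr (- \<delta>)" for j
  have w1: "w 1 = 1" using multiplicative[of 1 1] pos[of 1] by simp
  have X: "0 \<le> (\<Sum>j | j dvd N. X j)" if "N \<ge> 1" for N
    using bessel_on_divisors[OF hol bd ser that, of c]
    by (simp add: X_def sum_subtractf sum_distrib_left algebra_simps)
  have dec: "r (p ^ Suc i) \<le> r (p ^ i)" if p: "prime p" for p i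
  proof -
    have p0: "real p > 0" using prime_gt_0_nat[OF p] by simp
    have W: "w (p ^ i) > 0" "w (p ^ Suc i) > 0" using pos prime_gt_0_nat[OF p] by (simp_all add: Suc_le_eq)
    have "w (p ^ i) / w (p ^ Suc i) \<le> real p powr (- \<delta>)"
      using growth[of "Suc i" p] p by (simp add: \<delta>_def)
    then have "w (p ^ i) / w (p ^ Suc i) * real p powr \<delta> \<le> 1"
      using mult_right_mono[of _ _ "real p powr \<delta>"] p0 by (fastforce simp: powr_add[symmetric])
    moreover have "r (p ^ Suc i) = r (p ^ i) * (w (p ^ i) / w (p ^ Suc i) * real p powr \<delta>)"
      using W p0 by (simp add: r_def powr_mult)
    moreover have "0 \<le> r (p ^ i)" using W(1) by (simp add: r_def)
    ultimately show ?thesis by (simp only: mult_left_le)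
  qed
  have rn: "0 \<le> r j" for j
    using pos[of j] by (cases "j = 0") (auto simp: r_def intro: less_imp_le)
  have rm: "r (m * n) = r m * r n" if "m \<ge> 1" "n \<ge> 1" "coprime m n" for m n
    using multiplicative[OF that] by (simp add: r_def powr_mult)
  have ineq: "(\<Sum>j | j dvd N. (cmod (?b j))\<^sup>2 / w j) \<le> K\<^sup>2 * (\<Sum>j | j dvd N. (cmod (c j))\<^sup>2 / w j)"
    if N: "N \<ge> 1" for N
  proof -
    have "X j * r j = K\<^sup>2 * ((cmod (c j))\<^sup>2 / w j) - (cmod (?b j))\<^sup>2 / w j" if "j dvd N" for j
    proof -
      have "real j powr (- \<delta>) * real j powr \<delta> = 1"
        using that N by (cases "j = 0") (auto simp: powr_add[symmetric])
      then have "X j * r j = (K\<^sup>2 * (cmod (c j))\<^sup>2 - (cmod (?b j))\<^sup>2) * 1 / w j"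
        unfolding X_def r_def by (metis (no_types, lifting) mult.assoc times_divide_eq_right)
      then show ?thesis by (simp add: diff_divide_distrib)
    qed
    moreover have "0 \<le> (\<Sum>j | j dvd N. X j * r j)"
      by (rule divisor_sums_weight[OF X rm _ rn dec N]) (use w1 in \<open>simp_all add: r_def\<close>)
    ultimately show ?thesis by (simp add: sum_subtractf sum_distrib_left)
  qed
  have part: "(\<Sum>j<n. (cmod (?b j))\<^sup>2 / w j) \<le> K\<^sup>2 * ell2_sq w c" for n
  proof -
    have nn: "0 \<le> (cmod (?b j))\<^sup>2 / w j" for j using pos[of j] by (cases "j = 0") auto
    \<comment> \<open>All indices below \<open>n\<close> are divisors of \<open>fact n\<close>.\<close>
    have "(\<Sum>j<n. (cmod (?b j))\<^sup>2 / w j) = (\<Sum>j\<in>{1..<n}. (cmod (?b j))\<^sup>2 / w j)"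
      by (rule sum.mono_neutral_right) (auto simp: not_le)
    also have "\<dots> \<le> (\<Sum>j | j dvd fact n. (cmod (?b j))\<^sup>2 / w j)"
      by (rule sum_mono2) (auto simp: nn intro: dvd_fact)
    also have "\<dots> \<le> K\<^sup>2 * (\<Sum>j | j dvd fact n. (cmod (c j))\<^sup>2 / w j)"
      by (rule ineq) simp
    also have "\<dots> \<le> K\<^sup>2 * ell2_sq w c"
      by (intro mult_left_mono ell2_partial_sum_le c) auto
    finally show ?thesis .
  qed
  show "?b \<in> ell2 w" "ell2_sq w ?b \<le> K\<^sup>2 * ell2_sq w c"
    using ell2I_bounded[of ?b] part by auto
qed

text \<open>The series of \<open>\<phi>\<close> is only known to converge far to the right. The inequality for the convolution puts its
  coefficients into the sequence space; its series then converges on the whole domain of that space,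
  where it agrees with \<open>\<phi>\<close> by analytic continuation.\<close>

lemma bounded_function_multiplier:
  assumes hol: "\<phi> holomorphic_on {s. \<delta> / 2 < Re s}" and bd: "\<And>s. \<delta> / 2 < Re s \<Longrightarrow> cmod (\<phi> s) \<le> K"
    and ser: "has_dirichlet_series \<phi> a"
  obtains b where "b \<in> multiplier_sequences" "multiplier_norm w (ell2_fun b) \<le> K"
    "\<And>s. s \<in> H_domain w \<Longrightarrow> \<phi> s = ell2_fun b s"
proof -
  define b where "b = a(0 := 0)"
  have ser': "has_dirichlet_series \<phi> b"
    using ser by (simp add: has_dirichlet_series_def dirichlet_sums_def b_def)
  have conv: "dirichlet_conv b c \<in> ell2 w" "ell2_sq w (dirichlet_conv b c) \<le> K\<^sup>2 * ell2_sq w c"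
    if "c \<in> ell2 w" for c
    using bounded_function_conv[OF hol bd ser' that] by auto
  \<comment> \<open>The unit of the convolution; \<open>b = b * e\<close> is the image of the constant function 1.\<close>
  define e :: "nat \<Rightarrow> complex" where "e j = (if j = 1 then 1 else 0)" for j
  have e: "e \<in> ell2 w" by (rule ell2_finite_support(1)[of _ 1]) (auto simp: e_def)
  have "dirichlet_conv b e j = b j" for j
  proof (cases "j = 0")
    case False
    have "dirichlet_conv b e j = (\<Sum>d\<in>{j}. b d * e (j div d))"
      unfolding dirichlet_conv_def
    proof (rule sum.mono_neutral_right)
      show "\<forall>d\<in>{d. d dvd j} - {j}. b d * e (j div d) = 0"
        using False by (auto simp: e_def elim!: dvdE)
    qed (use False in auto)
    then show ?thesis using False by (simp add: e_def)
  qed (simp add: b_def)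
  then have "dirichlet_conv b e = b" by blast
  then have bl: "b \<in> ell2 w" using conv(1)[OF e] by simp
  then have bm: "b \<in> multiplier_sequences" using conv(1) by (simp add: multiplier_sequences_def)
  have "0 \<le> cmod (\<phi> (of_real (\<delta> / 2 + 1)))" by simp
  also have "\<dots> \<le> K" by (rule bd) simp
  finally have K: "0 \<le> K" .
  obtain x where x: "converges_absolutely b x" "\<And>s. x \<le> Re s \<Longrightarrow> \<phi> s = dirichlet_value b s"
    using has_dirichlet_series_absolutely[OF ser'] by blast
  have "\<phi> s = ell2_fun b s" if s: "s \<in> H_domain w" for s
  proof (rule analytic_continuation_open[of "{s. max x (\<sigma> / 2) < Re s}" "H_domain w" \<phi> "ell2_fun b"])
    show "{s. max x (\<sigma> / 2) < Re s} \<noteq> {}"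
      by (auto intro!: exI[of _ "of_real (max x (\<sigma> / 2) + 1)"])
    show "\<phi> holomorphic_on H_domain w"
      by (rule holomorphic_on_subset[OF hol H_domain_subset])
    show "\<phi> z = ell2_fun b z" if "z \<in> {s. max x (\<sigma> / 2) < Re s}" for z
      using that x(2) by (simp add: ell2_fun_def H_domain_eq)
    show "open {s. max x (\<sigma> / 2) < Re s}" by (rule open_halfspace_Re_gt)
    show "open (H_domain w)" unfolding H_domain_eq by (rule open_halfspace_Re_gt)
    show "connected (H_domain w)"
      unfolding H_domain_eq by (intro convex_connected convex_halfspace_Re_gt)
    show "{s. max x (\<sigma> / 2) < Re s} \<subseteq> H_domain w" by (auto simp: H_domain_eq)
  qed (use s ell2_fun_holomorphic[OF bl] in auto)
  then show ?thesis
    using that[OF bm] multiplier_norm_least[OF bm K conv(2)] by blast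
qed

section \<open>The isometric isomorphism\<close>

lemma multipliers_isometrically_isomorphic:
  "isometrically_isomorphic (multipliers w) (multiplier_norm w)
    (H_infinity (half_plane (delta_abscissa w / 2)) \<inter> dirichlet_representable)
    (sup_norm (half_plane (delta_abscissa w / 2)))"
proof -
  let ?S = "{s. \<delta> / 2 < Re s}"
  let ?B = "H_infinity ?S \<inter> dirichlet_representable"
  define E where "E \<phi> \<psi> \<longleftrightarrow> \<psi> \<in> functions_on ?S \<and> \<psi> holomorphic_on ?S \<and> (\<forall>s\<in>H_domain w. \<psi> s = \<phi> s)"
    for \<phi> \<psi> :: "complex \<Rightarrow> complex"
  define \<Phi> where "\<Phi> \<phi> = (THE \<psi>. E \<phi> \<psi>)" for \<phi>
  have uniq: "\<psi> = \<psi>'" if "E \<phi> \<psi>" "E \<phi> \<psi>'" for \<phi> \<psi> \<psi>'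
  proof
    fix s
    show "\<psi> s = \<psi>' s"
    proof (cases "s \<in> ?S")
      case True
      then show ?thesis
        using that by (intro holomorphic_eq_on_half_plane[of \<psi> \<psi>' s]) (auto simp: E_def)
    next
      case False
      moreover have "\<psi> \<in> functions_on ?S" "\<psi>' \<in> functions_on ?S"
        using that by (simp_all only: E_def)
      ultimately have "\<psi> s = 0" "\<psi>' s = 0"
        unfolding functions_on_def by blast+
      then show ?thesis by simp
    qed
  qed
  have \<Phi>_eq: "\<Phi> \<phi> = \<psi>" if "E \<phi> \<psi>" for \<phi> \<psi>
    unfolding \<Phi>_def by (rule the_equality[of "E \<phi>", OF that uniq[OF _ that]])
  have ext: "E \<phi> (\<Phi> \<phi>) \<and> \<Phi> \<phi> \<in> ?B \<and> sup_norm ?S (\<Phi> \<phi>) \<le> multiplier_norm w \<phi>"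
    if \<phi>: "\<phi> \<in> multipliers w" for \<phi>
  proof -
    obtain a where a: "a \<in> multiplier_sequences" "\<phi> = ell2_fun a" using \<phi> by (auto simp: multipliers_eq)
    obtain g where g: "g holomorphic_on ?S" "\<And>s. s \<in> ?S \<Longrightarrow> cmod (g s) \<le> multiplier_norm w \<phi>"
      "\<And>s. s \<in> H_domain w \<Longrightarrow> g s = \<phi> s"
      using multiplier_extends[OF a(1)] a(2) by auto
    define \<psi> where "\<psi> s = (if s \<in> ?S then g s else 0)" for s
    have hol: "\<psi> holomorphic_on ?S"
      using g(1) by (rule holomorphic_transform) (simp add: \<psi>_def)
    have E: "E \<phi> \<psi>"
      using hol g(3) H_domain_subset by (auto simp: E_def functions_on_def \<psi>_def)
    have "has_dirichlet_series \<psi> a"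
      unfolding has_dirichlet_series_def
    proof (intro exI ballI)
      fix s assume "s \<in> half_plane (ereal (\<sigma> / 2))"
      then have "s \<in> H_domain w" by (simp add: half_plane_def H_domain_eq)
      then show "dirichlet_sums a s (\<psi> s)"
        using ell2_fun_sums[of a s] E a by (simp add: E_def multiplier_sequences_def)
    qed
    moreover have "bounded (\<psi> ` ?S)"
      using g(2) by (auto simp: bounded_iff \<psi>_def)
    ultimately have "\<psi> \<in> ?B"
      using hol E by (auto simp: H_infinity_def dirichlet_representable_def E_def)
    moreover have "sup_norm ?S \<psi> \<le> multiplier_norm w \<phi>"
      unfolding sup_norm_def
    proof (rule cSUP_least)
      show "?S \<noteq> {}" by (auto intro!: exI[of _ "of_real (\<delta> / 2 + 1)"])
    qed (simp add: \<psi>_def g(2))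
    ultimately show ?thesis using E \<Phi>_eq[OF E] by simp
  qed
  have res: "\<exists>\<phi>\<in>multipliers w. E \<phi> \<psi> \<and> multiplier_norm w \<phi> \<le> sup_norm ?S \<psi>" if \<psi>: "\<psi> \<in> ?B" for \<psi>
  proof -
    have hol: "\<psi> holomorphic_on ?S" and fs: "\<psi> \<in> functions_on ?S" and bd: "bounded (\<psi> ` ?S)"
      using \<psi> by (auto simp: H_infinity_def)
    obtain a where ser: "has_dirichlet_series \<psi> a"
      using \<psi> by (auto simp: dirichlet_representable_def)
    obtain M where "\<And>s. s \<in> ?S \<Longrightarrow> cmod (\<psi> s) \<le> M"
      using bd unfolding bounded_iff by blast
    then have "bdd_above ((\<lambda>s. cmod (\<psi> s)) ` ?S)" by (rule bdd_aboveI2)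
    then have "cmod (\<psi> s) \<le> sup_norm ?S \<psi>" if "\<delta> / 2 < Re s" for s
      unfolding sup_norm_def using that by (intro cSUP_upper) auto
    from bounded_function_multiplier[OF hol this ser] obtain b where
      "b \<in> multiplier_sequences" "multiplier_norm w (ell2_fun b) \<le> sup_norm ?S \<psi>"
      "\<And>s. s \<in> H_domain w \<Longrightarrow> \<psi> s = ell2_fun b s" by blast
    then show ?thesis using hol fs by (auto simp: multipliers_eq E_def)
  qed
  have agree: "\<phi> = \<phi>'" if "E \<phi> \<psi>" "E \<phi>' \<psi>" "\<phi> \<in> multipliers w" "\<phi>' \<in> multipliers w" for \<phi> \<phi>' \<psi>
  proof
    fix s show "\<phi> s = \<phi>' s"
      using that by (cases "s \<in> H_domain w") (auto simp: E_def multipliers_def functions_on_def)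
  qed
  have "bij_betw \<Phi> (multipliers w) ?B"
    unfolding bij_betw_def
  proof (intro conjI equalityI subsetI)
    show "inj_on \<Phi> (multipliers w)"
      using ext agree by (intro inj_onI) metis
    show "\<psi> \<in> ?B" if "\<psi> \<in> \<Phi> ` multipliers w" for \<psi> using that ext by blast
    show "\<psi> \<in> \<Phi> ` multipliers w" if "\<psi> \<in> ?B" for \<psi> using res[OF that] \<Phi>_eq by blast
  qed
  moreover have "\<Phi> (\<lambda>s. f s + g s) = (\<lambda>s. \<Phi> f s + \<Phi> g s)" "\<Phi> (\<lambda>s. f s * g s) = (\<lambda>s. \<Phi> f s * \<Phi> g s)"
    if "f \<in> multipliers w" "g \<in> multipliers w" for f g
    using ext[OF that(1)] ext[OF that(2)]
    by (auto intro!: \<Phi>_eq holomorphic_intros simp: E_def functions_on_def)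
  moreover have "\<Phi> (\<lambda>s. c * f s) = (\<lambda>s. c * \<Phi> f s)" if "f \<in> multipliers w" for f c
    using ext[OF that] by (auto intro!: \<Phi>_eq holomorphic_intros simp: E_def functions_on_def)
  moreover have "sup_norm ?S (\<Phi> f) = multiplier_norm w f" if f: "f \<in> multipliers w" for f
  proof (rule antisym)
    show "sup_norm ?S (\<Phi> f) \<le> multiplier_norm w f" using ext[OF f] by simp
    obtain \<phi> where "\<phi> \<in> multipliers w" "E \<phi> (\<Phi> f)" "multiplier_norm w \<phi> \<le> sup_norm ?S (\<Phi> f)"
      using res ext[OF f] by blast
    then show "multiplier_norm w f \<le> sup_norm ?S (\<Phi> f)" using agree ext[OF f] f by metis
  qed
  ultimately show ?thesis
    unfolding isometrically_isomorphic_def delta_half_plane by (intro exI[of _ \<Phi>]) blast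
qed

end

theorem theorem3p1:
  fixes w :: "nat \<Rightarrow> real"
  assumes "\<And>j. j \<ge> 1 \<Longrightarrow> w j > 0"
    and "sigma_abscissa w < \<infinity>"
    and "\<bar>delta_abscissa w\<bar> \<noteq> \<infinity>"
    and "\<And>m n. m \<ge> 1 \<Longrightarrow> n \<ge> 1 \<Longrightarrow> coprime m n \<Longrightarrow> w (m * n) = w m * w n"
    and "\<And>j p. j \<ge> 1 \<Longrightarrow> prime p \<Longrightarrow>
           w (p ^ (j - 1)) / w (p ^ j) \<le> real p powr (- real_of_ereal (delta_abscissa w))"
  shows "isometrically_isomorphic
           (multipliers w) (multiplier_norm w)
           (H_infinity (half_plane (delta_abscissa w / 2)) \<inter> dirichlet_representable)
           (sup_norm (half_plane (delta_abscissa w / 2)))"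
proof -
  interpret multiplicative_weight w
    by unfold_locales (fact assms)+
  show ?thesis by (rule multipliers_isometrically_isomorphic)
qed

end
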